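(* Let $(\mu_\varepsilon)_{0\le\varepsilon\le1}$ be a family of probability distributions on $\mathbb{R}$ with cumulant generating functions $K_\varepsilon$, and let $x\in\mathbb{R}$ satisfy $\int_{\mathbb{R}}y\,\mu_0(dy)\neq x$. Assume: (A1) for each $\varepsilon\in[0,1]$, the effective domain $\mathcal{D}_\varepsilon$ of $K_\varepsilon$ contains an open interval that includes $0$; (A2) for each $\varepsilon\in[0,1]$, the support of $\mu_\varepsilon$ is equal to $\mathbb{R}$, and the characteristic function of $\mu_\varepsilon$ is integrable, i.e. $\int_{-\infty}^\infty\left|\int_{-\infty}^\infty e^{i\xi y}\mu_\varepsilon(dy)\right|d\xi<\infty$; (A3) there is $\delta_0>0$ such that $K''_\varepsilon(\theta)\ge\delta_0$ for each $\theta\in\mathcal{O}_\varepsilon$ and $\varepsilon\in[0,1]$; (A4) for each $\varepsilon$ there is an interval $\mathcal{I}_\varepsilon\subset\mathcal{D}_\varepsilon$ such that $\mathcal{I}_\varepsilon\nearrow\mathbb{R}$ as $\varepsilon\to0$; that is, $\mathcal{I}_\varepsilon\subset\mathcal{I}_{\varepsilon'}$ for each $\varepsilon\ge\varepsilon'$, and $\bigcup_\varepsilon\mathcal{I}_\varepsilon=\mathbb{R}$; (A5) for each nonnegative integer $r$, $K^{(r)}_\varepsilon$ converges to $K^{(r)}_0$ uniformly on any compact subset of $\mathbb{R}$ as $\varepsilon\to0$; moreover, for each integer $r\ge3$ and each compact $C\subset\mathbb{R}$, $\limsup_{\varepsilon\to0}\sup_{\theta\in C}\varepsilon^{-(r-2)}|K^{(r)}_\varepsilon(\theta)|<\infty$;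 (A6) there exists $\varepsilon_0\in(0,1]$ such that $\sum_{k=2}^\infty\frac{C_k}{k!}\varepsilon_0^k<\infty$, where $C_n$ ($n\ge2$) are the positive constants, described in the context, in the bounds $|\hat\theta^{(n)}_\varepsilon|\le C_n\varepsilon^{n-1}$. Then $h_\varepsilon^{(n)}(\hat w_\varepsilon)=O(\varepsilon^n)$ as $\varepsilon\to0$ for each $n\ge1$. Moreover, $\Psi^\varepsilon_m(\hat w_\varepsilon)=O(\varepsilon^{2m+1})$ as $\varepsilon\to0$ for each $m\ge0$.
   Context: $K_\varepsilon(\theta)=\log\int_{\mathbb{R}}e^{\theta y}\mu_\varepsilon(dy)$; $\mathcal{D}_\varepsilon=\{\theta\in\mathbb{R}:|K_\varepsilon(\theta)|<\infty\}$; $\mathcal{O}_\varepsilon$ is the interior of $\mathcal{D}_\varepsilon$. The saddlepoint $\hat\theta_\varepsilon\in\mathcal{O}_\varepsilon$ is the solution of $K'_\varepsilon(\hat\theta_\varepsilon)=x$; the source states that under (A1)–(A2) $K_\varepsilon$ is strictly convex and the range of $K'_\varepsilon$ is $\mathbb{R}$, so that this solution always exists. (By (A4), every compact set lies in $\mathcal{D}_\varepsilon$ for small $\varepsilon$, so (A5) makes sense for small $\varepsilon$; under the assumptions $\hat\theta_\varepsilon\ne0$ for small $\varepsilon$.) Set $\mathrm{sgn}(a)=1$ for $a\ge0$, $-1$ for $a<0$, and $\hat w_\varepsilon=\mathrm{sgn}(\hat\theta_\varepsilon)\sqrt{2(x\hat\theta_\varepsilon-K_\varepsilon(\hat\theta_\varepsilon))}$.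 Put $$w_\varepsilon(\theta)=\hat w_\varepsilon+\mathrm{sgn}(\theta-\hat\theta_\varepsilon)\sqrt{2\{(K_\varepsilon(\theta)-x\theta)-(K_\varepsilon(\hat\theta_\varepsilon)-x\hat\theta_\varepsilon)\}},$$ which is real analytic on $\mathcal{O}_\varepsilon$ with nonvanishing derivative; let $\theta_\varepsilon(w)$ be its analytic inverse function, and $\hat\theta^{(n)}_\varepsilon=\frac{d^n\theta_\varepsilon}{dw^n}(\hat w_\varepsilon)$. Constants $C_n$: under (A1)–(A5) one has, for each $n\ge2$, $\hat\theta^{(n)}_\varepsilon=O(\varepsilon^{n-1})$ as $\varepsilon\to0$; accordingly there are positive constants $C_n$ ($n\ge2$) such that $|\hat\theta^{(n)}_\varepsilon|\le C_n\varepsilon^{n-1}$. These are the constants in (A6). Near $\hat w_\varepsilon$ define $h_\varepsilon(w)=\log(\theta_\varepsilon(w)/w)$, $\psi_\varepsilon(w)=h_\varepsilon'(w)=\frac{\theta_\varepsilon'(w)}{\theta_\varepsilon(w)}-\frac1w$, and $$\Psi^\varepsilon_m(w)=\phi(w)\frac{(-1)^m}{(2m)!!}\psi_\varepsilon^{(2m)}(w),$$ with $(2m)!!=(2m)(2m-2)\cdots4\cdot2$, $0!!=1$, and $\phi(y)=\frac1{\sqrt{2\pi}}e^{-y^2/2}$. $a_\varepsilon=O(\varepsilon^r)$ as $\varepsilon\to0$ means $\limsup_{\varepsilon\to0}\varepsilon^{-r}|a_\varepsilon|<\infty$. *)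

theory Defs
  imports "HOL-Probability.Probability" "HOL-Library.Landau_Symbols"
begin

definition measure_support :: "real measure \<Rightarrow> real set" where
  "measure_support M = {y. \<forall>U. open U \<longrightarrow> y \<in> U \<longrightarrow> measure M U > 0}"

(* Meaningful only on cgf_domain M: elsewhere the Bochner integral is 0. *)
definition cgf :: "real measure \<Rightarrow> real \<Rightarrow> real" where
  "cgf M \<theta> = ln (LINT y|M. exp (\<theta> * y))"

(* The integrand is positive, so the logarithm of its integral over a
   probability measure is finite iff the integral is, i.e. iff exp (\<theta> * y)
   is integrable. *)
definition cgf_domain :: "real measure \<Rightarrow> real set" where
  "cgf_domain M = {\<theta>. integrable M (\<lambda>y. exp (\<theta> * y))}"

definition cgf_open_domain :: "real measure \<Rightarrow> real set" where
  "cgf_open_domain M = interior (cgf_domain M)"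

(* Unlike the library constant sgn, this has value 1 at 0. *)
definition sgn1 :: "real \<Rightarrow> real" where
  "sgn1 a = (if a \<ge> 0 then 1 else -1)"

(* Unspecified when the equation has no solution, or more than one. *)
definition saddlepoint :: "real measure \<Rightarrow> real \<Rightarrow> real" where
  "saddlepoint M x = (THE \<theta>. \<theta> \<in> cgf_open_domain M \<and> deriv (cgf M) \<theta> = x)"

definition w_hat :: "real measure \<Rightarrow> real \<Rightarrow> real" where
  "w_hat M x = (let s = saddlepoint M x in
     sgn1 s * sqrt (2 * (x * s - cgf M s)))"

definition w_map :: "real measure \<Rightarrow> real \<Rightarrow> real \<Rightarrow> real" where
  "w_map M x \<theta> = (let s = saddlepoint M x in
     w_hat M x + sgn1 (\<theta> - s) * sqrt (2 * ((cgf M \<theta> - x * \<theta>) - (cgf M s - x * s))))"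

(* The inverse of the restriction of w_map to the open domain; it is the
   analytic inverse on the image, which is a neighbourhood of w_hat. *)
definition theta_map :: "real measure \<Rightarrow> real \<Rightarrow> real \<Rightarrow> real" where
  "theta_map M x = inv_into (cgf_open_domain M) (w_map M x)"

definition theta_hat_deriv :: "nat \<Rightarrow> real measure \<Rightarrow> real \<Rightarrow> real" where
  "theta_hat_deriv n M x = (deriv ^^ n) (theta_map M x) (w_hat M x)"

definition h_fun :: "real measure \<Rightarrow> real \<Rightarrow> real \<Rightarrow> real" where
  "h_fun M x w = ln (theta_map M x w / w)"

definition psi_fun :: "real measure \<Rightarrow> real \<Rightarrow> real \<Rightarrow> real" where
  "psi_fun M x = deriv (h_fun M x)"

(* The product is the double factorial (2m)!!. *)
definition Psi_fun :: "nat \<Rightarrow> real measure \<Rightarrow> real \<Rightarrow> real \<Rightarrow> real" where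
  "Psi_fun m M x w =
     std_normal_density w * ((-1) ^ m / (\<Prod>k=1..m. 2 * real k)) * (deriv ^^ (2 * m)) (psi_fun M x) w"

end

(*
  Write K for the cumulant generating function, s for the saddlepoint and f for K - x * id. Then
  f(t) - f(s) = (t - s)^2 q(t), where q is a weighted mean of K'' over the segment from s to t, so that
  w(t) = w_hat + (t - s) sqrt (2 q(t)) and w'(t) = r(t) / sqrt (2 q(t)), where r is the plain mean of K''.
  As w(0) = 0, the quotient v(t) = w(t) / t is the mean of w' over the segment from 0 to t, and
  h(w(t)) = - ln (v(t)); hence the n-th derivative of h at w(t) is D^n (- ln v) (t) with D = (1 / w') d/dt.
  By (A5), K'' belongs to the class of families whose n-th derivative is O(eps^n) uniformly on a
  fixed interval. This class is closed under products, means along segments and, given a positive lower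
  bound, inverse, sqrt and ln; so it contains 1 / w' and ln v, and each application of D gains a power
  of eps. Evaluating at t = s gives the claim.
*)
theory Submission
  imports Defs
begin

section \<open>Families whose derivatives gain powers of the parameter\<close>

text \<open>The saddlepoint moves with the parameter, while (A5) speaks of fixed compact sets. By
  (A3) the derivative of the limit cgf grows at least linearly, so it crosses \<open>x\<close>
  strictly inside an explicit interval; by convergence the saddlepoints for small parameters stay in
  that interval, and all estimates are uniform there. (A3) also supplies the positive lower bounds
  that inverses, roots and logarithms require. To iterate D, the formula for the n-th derivative has
  to hold on an open set and not just at s. This set is the interval without 0, because at t = 0 the
  quotient defining h is 0 / 0. The hypothesis on the mean makes s differ from 0 for small
  parameters, so that s belongs to the set.\<close>

text \<open>
  Each derivative gains one power of the parameter. The range of parameters in which the bounds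
  hold may depend on the order of the derivative, as it does in (A5).
\<close>

definition order_bound :: "real set \<Rightarrow> nat \<Rightarrow> (real \<Rightarrow> real \<Rightarrow> real) \<Rightarrow> bool" where
  "order_bound J k F \<longleftrightarrow> (\<exists>B. \<forall>\<^sub>F e in at_right 0. \<forall>x\<in>J. \<bar>F e x\<bar> \<le> B * e ^ k)"

text \<open>The derivative is an existential witness rather than \<open>deriv\<close>, so that
  closure rules can supply it as an explicit formula. The level \<open>N\<close> is the induction
  measure where such a formula contains the original function again.\<close>

primrec graded_upto :: "real set \<Rightarrow> nat \<Rightarrow> nat \<Rightarrow> (real \<Rightarrow> real \<Rightarrow> real) \<Rightarrow> bool" where
  "graded_upto J 0 k F \<longleftrightarrow> order_bound J k F"
| "graded_upto J (Suc N) k F \<longleftrightarrow> order_bound J k F \<and>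
     (\<exists>G. (\<forall>\<^sub>F e in at_right 0. \<forall>x\<in>J. (F e has_real_derivative G e x) (at x)) \<and>
          graded_upto J N (Suc k) G)"

definition graded :: "real set \<Rightarrow> nat \<Rightarrow> (real \<Rightarrow> real \<Rightarrow> real) \<Rightarrow> bool" where
  "graded J k F \<longleftrightarrow> (\<forall>N. graded_upto J N k F)"

lemma graded_upto_order_bound: "graded_upto J N k F \<Longrightarrow> order_bound J k F"
  by (cases N) auto

lemma graded_order_bound: "graded J k F \<Longrightarrow> order_bound J k F"
  by (auto simp: graded_def intro: graded_upto_order_bound)

lemma graded_upto_SucD: "graded_upto J (Suc N) k F \<Longrightarrow> graded_upto J N k F"
proof (induction N arbitrary: k F)
  case (Suc N)
  from Suc.prems show ?case using Suc.IH by (subst graded_upto.simps(2)) auto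
qed simp

lemma order_bound_cong:
  assumes "\<forall>\<^sub>F e in at_right 0. \<forall>x\<in>J. F e x = G e x" "order_bound J k F"
  shows "order_bound J k G"
proof -
  from assms(2) obtain B where "\<forall>\<^sub>F e in at_right 0. \<forall>x\<in>J. \<bar>F e x\<bar> \<le> B * e ^ k"
    by (auto simp: order_bound_def)
  with assms(1) have "\<forall>\<^sub>F e in at_right 0. \<forall>x\<in>J. \<bar>G e x\<bar> \<le> B * e ^ k"
    by eventually_elim auto
  then show ?thesis by (auto simp: order_bound_def)
qed

lemma graded_upto_cong:
  assumes J: "open J" and eq: "\<forall>\<^sub>F e in at_right 0. \<forall>x\<in>J. F e x = G e x"
    and F: "graded_upto J N k F"
  shows "graded_upto J N k G"
proof (cases N)
  case 0
  with F eq show ?thesis by (auto intro: order_bound_cong)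
next
  case (Suc N')
  with F obtain D where D: "\<forall>\<^sub>F e in at_right 0. \<forall>x\<in>J. (F e has_real_derivative D e x) (at x)"
    "graded_upto J N' (Suc k) D" by auto
  from D(1) eq have "\<forall>\<^sub>F e in at_right 0. \<forall>x\<in>J. (G e has_real_derivative D e x) (at x)"
    by eventually_elim (use J in \<open>blast intro: has_field_derivative_transform_within_open\<close>)
  with D(2) Suc show ?thesis
    using order_bound_cong[OF eq graded_upto_order_bound[OF F]] by auto
qed

text \<open>One derivative suffices when it is already known to be graded, as for constants and
  logarithms; no induction on the level is then required.\<close>

lemma gradedI:
  assumes "order_bound J k F"
    and "\<forall>\<^sub>F e in at_right 0. \<forall>x\<in>J. (F e has_real_derivative G e x) (at x)"
    and "graded J (Suc k) G"
  shows "graded J k F"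
  unfolding graded_def
proof
  fix N show "graded_upto J N k F"
    by (cases N) (use assms in \<open>auto simp: graded_def\<close>)
qed

text \<open>\<open>graded\<close> allows a different witness of the derivative at each level.
  Uniqueness of derivatives identifies all of them on \<open>J\<close> with \<open>deriv\<close>,
  which then serves every level at once.\<close>

lemma graded_derivative:
  assumes J: "open J" and F: "graded J k F"
  shows "graded J (Suc k) (\<lambda>e. deriv (F e))"
    and "\<forall>\<^sub>F e in at_right 0. \<forall>x\<in>J. (F e has_real_derivative deriv (F e) x) (at x)"
proof -
  have *: "graded_upto J N (Suc k) (\<lambda>e. deriv (F e)) \<and>
      (\<forall>\<^sub>F e in at_right 0. \<forall>x\<in>J. (F e has_real_derivative deriv (F e) x) (at x))" for N
  proof -
    from F have "graded_upto J (Suc N) k F" unfolding graded_def by blast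
    then obtain G where G: "\<forall>\<^sub>F e in at_right 0. \<forall>x\<in>J. (F e has_real_derivative G e x) (at x)"
      "graded_upto J N (Suc k) G" by auto
    from G(1) have eq: "\<forall>\<^sub>F e in at_right 0. \<forall>x\<in>J. G e x = deriv (F e) x"
      by eventually_elim (metis DERIV_imp_deriv)
    from G(1) have "\<forall>\<^sub>F e in at_right 0. \<forall>x\<in>J. (F e has_real_derivative deriv (F e) x) (at x)"
      by eventually_elim (metis DERIV_imp_deriv)
    with graded_upto_cong[OF J eq G(2)] show ?thesis by blast
  qed
  show "graded J (Suc k) (\<lambda>e. deriv (F e))" using * by (auto simp: graded_def)
  show "\<forall>\<^sub>F e in at_right 0. \<forall>x\<in>J. (F e has_real_derivative deriv (F e) x) (at x)"
    using * by blast
qed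

section \<open>Closure of the graded class under arithmetic, roots and logarithms\<close>

lemma order_bound_add:
  assumes "order_bound J k F" "order_bound J k G"
  shows "order_bound J k (\<lambda>e x. F e x + G e x)"
proof -
  from assms obtain A B where "\<forall>\<^sub>F e in at_right 0. \<forall>x\<in>J. \<bar>F e x\<bar> \<le> A * e ^ k"
    and "\<forall>\<^sub>F e in at_right 0. \<forall>x\<in>J. \<bar>G e x\<bar> \<le> B * e ^ k" by (auto simp: order_bound_def)
  then have "\<forall>\<^sub>F e in at_right 0. \<forall>x\<in>J. \<bar>F e x + G e x\<bar> \<le> (A + B) * e ^ k"
  proof eventually_elim
    case (elim e)
    show ?case
    proof
      fix x assume "x \<in> J"
      then show "\<bar>F e x + G e x\<bar> \<le> (A + B) * e ^ k"
        using elim abs_triangle_ineq[of "F e x" "G e x"] by (force simp: distrib_right)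
    qed
  qed
  then show ?thesis by (auto simp: order_bound_def)
qed

lemma order_bound_mult:
  assumes "order_bound J j F" "order_bound J k G"
  shows "order_bound J (j + k) (\<lambda>e x. F e x * G e x)"
proof -
  from assms obtain A B where "\<forall>\<^sub>F e in at_right 0. \<forall>x\<in>J. \<bar>F e x\<bar> \<le> A * e ^ j"
    and "\<forall>\<^sub>F e in at_right 0. \<forall>x\<in>J. \<bar>G e x\<bar> \<le> B * e ^ k" by (auto simp: order_bound_def)
  then have "\<forall>\<^sub>F e in at_right 0. \<forall>x\<in>J. \<bar>F e x * G e x\<bar> \<le> (A * B) * e ^ (j + k)"
  proof eventually_elim
    case (elim e)
    show ?case
    proof
      fix x assume x: "x \<in> J"
      have "\<bar>F e x\<bar> * \<bar>G e x\<bar> \<le> (A * e ^ j) * (B * e ^ k)"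
        using elim x by (intro mult_mono) (auto intro: order_trans[OF abs_ge_zero])
      then show "\<bar>F e x * G e x\<bar> \<le> (A * B) * e ^ (j + k)"
        by (simp add: abs_mult power_add mult_ac)
    qed
  qed
  then show ?thesis by (auto simp: order_bound_def)
qed

lemma graded_upto_add:
  "graded_upto J N k F \<Longrightarrow> graded_upto J N k G \<Longrightarrow> graded_upto J N k (\<lambda>e x. F e x + G e x)"
proof (induction N arbitrary: k F G)
  case 0
  then show ?case by (auto intro: order_bound_add)
next
  case (Suc N)
  from Suc.prems obtain F' G' where
    F: "\<forall>\<^sub>F e in at_right 0. \<forall>x\<in>J. (F e has_real_derivative F' e x) (at x)"
       "graded_upto J N (Suc k) F'" and
    G: "\<forall>\<^sub>F e in at_right 0. \<forall>x\<in>J. (G e has_real_derivative G' e x) (at x)"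
       "graded_upto J N (Suc k) G'" by auto
  have "\<forall>\<^sub>F e in at_right 0. \<forall>x\<in>J.
      ((\<lambda>x. F e x + G e x) has_real_derivative F' e x + G' e x) (at x)"
    using F(1) G(1) by eventually_elim (auto intro: DERIV_add)
  moreover have "graded_upto J N (Suc k) (\<lambda>e x. F' e x + G' e x)"
    using F(2) G(2) by (rule Suc.IH)
  moreover have "order_bound J k (\<lambda>e x. F e x + G e x)"
    using Suc.prems by (intro order_bound_add) auto
  ultimately show ?case
    unfolding graded_upto.simps by (intro conjI exI[of _ "\<lambda>e x. F' e x + G' e x"])
qed

lemma graded_upto_mult:
  "graded_upto J N j F \<Longrightarrow> graded_upto J N k G \<Longrightarrow>
   graded_upto J N (j + k) (\<lambda>e x. F e x * G e x)"
proof (induction N arbitrary: j k F G)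
  case 0
  then show ?case by (auto intro: order_bound_mult)
next
  case (Suc N)
  from Suc.prems obtain F' G' where
    F: "\<forall>\<^sub>F e in at_right 0. \<forall>x\<in>J. (F e has_real_derivative F' e x) (at x)"
       "graded_upto J N (Suc j) F'" and
    G: "\<forall>\<^sub>F e in at_right 0. \<forall>x\<in>J. (G e has_real_derivative G' e x) (at x)"
       "graded_upto J N (Suc k) G'" by auto
  have "\<forall>\<^sub>F e in at_right 0. \<forall>x\<in>J.
      ((\<lambda>x. F e x * G e x) has_real_derivative F' e x * G e x + F e x * G' e x) (at x)"
    using F(1) G(1) by eventually_elim (auto intro!: derivative_eq_intros)
  \<comment> \<open>Either term contains one derivative and so has order \<open>Suc (j + k)\<close>;
    the undifferentiated factor is known up to one level more than required.\<close>
  moreover have "graded_upto J N (Suc (j + k)) (\<lambda>e x. F' e x * G e x + F e x * G' e x)"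
    using Suc.IH[OF F(2) graded_upto_SucD[OF Suc.prems(2)]]
      Suc.IH[OF graded_upto_SucD[OF Suc.prems(1)] G(2)]
    by (intro graded_upto_add) auto
  moreover have "order_bound J (j + k) (\<lambda>e x. F e x * G e x)"
    using Suc.prems by (intro order_bound_mult) auto
  ultimately show ?case
    unfolding graded_upto.simps
    by (intro conjI exI[of _ "\<lambda>e x. F' e x * G e x + F e x * G' e x"])
qed

lemma graded_mult:
  "graded J j F \<Longrightarrow> graded J k G \<Longrightarrow> graded J (j + k) (\<lambda>e x. F e x * G e x)"
  by (auto simp: graded_def intro: graded_upto_mult)

lemma graded_upto_zero: "graded_upto J N k (\<lambda>e x. 0)"
proof (induction N arbitrary: k)
  case (Suc N)
  then show ?case
    by (auto simp: order_bound_def intro!: exI[of _ "\<lambda>e x. 0"] exI[of _ 0])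
qed (auto simp: order_bound_def intro!: exI[of _ 0])

lemma graded_const: "graded J 0 (\<lambda>e x. c)"
  by (rule gradedI[where G = "\<lambda>e x. 0"])
    (auto simp: order_bound_def graded_def graded_upto_zero)

lemma graded_cmult: "graded J k F \<Longrightarrow> graded J k (\<lambda>e x. c * F e x)"
  using graded_mult[OF graded_const] by force

lemma order_bound_inverse:
  assumes "c > 0" "\<forall>\<^sub>F e in at_right 0. \<forall>x\<in>J. c \<le> F e x"
  shows "order_bound J 0 (\<lambda>e x. inverse (F e x))"
  unfolding order_bound_def
proof (intro exI)
  show "\<forall>\<^sub>F e in at_right 0. \<forall>x\<in>J. \<bar>inverse (F e x)\<bar> \<le> inverse c * e ^ 0"
    using assms(2)
  proof eventually_elim
    case (elim e)
    then show ?case using \<open>c > 0\<close> by (fastforce intro!: le_imp_inverse_le)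
  qed
qed

text \<open>The derivative of 1 / F contains 1 / F again, so \<open>gradedI\<close> would be
  circular. Induction on the level resolves this: level \<open>Suc N\<close> of 1 / F asks only for
  level \<open>N\<close> of its derivative.\<close>

lemma graded_inverse:
  assumes c: "c > 0" "\<forall>\<^sub>F e in at_right 0. \<forall>x\<in>J. c \<le> F e x" and F: "graded J 0 F"
  shows "graded J 0 (\<lambda>e x. inverse (F e x))"
  unfolding graded_def
proof
  fix N show "graded_upto J N 0 (\<lambda>e x. inverse (F e x))"
  proof (induction N)
    case 0
    show ?case using order_bound_inverse[OF c] by simp
  next
    case (Suc N)
    from F have "graded_upto J (Suc N) 0 F" unfolding graded_def by blast
    then obtain F' where
      F': "\<forall>\<^sub>F e in at_right 0. \<forall>x\<in>J. (F e has_real_derivative F' e x) (at x)"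
       "graded_upto J N 1 F'" by auto
    let ?D = "\<lambda>e x. (- 1) * (F' e x * (inverse (F e x) * inverse (F e x)))"
    have "\<forall>\<^sub>F e in at_right 0. \<forall>x\<in>J.
        ((\<lambda>x. inverse (F e x)) has_real_derivative ?D e x) (at x)"
      using F'(1) c(2)
    proof eventually_elim
      case (elim e)
      show ?case
      proof
        fix x assume x: "x \<in> J"
        with elim c(1) have "F e x \<noteq> 0" by force
        with elim x show "((\<lambda>x. inverse (F e x)) has_real_derivative ?D e x) (at x)"
          by (auto intro!: derivative_eq_intros simp: power2_eq_square field_simps)
      qed
    qed
    \<comment> \<open>The order is a nested sum matching the factors of \<open>?D\<close>: the
      constant, \<open>F'\<close> with its gained power, and two factors of order 0.\<close>
    moreover have "graded_upto J N (0 + (1 + (0 + 0))) ?D"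
      using Suc.IH F'(2) graded_const[of J "-1"]
      by (intro graded_upto_mult) (auto simp: graded_def)
    ultimately show ?case
      using order_bound_inverse[OF c] unfolding graded_upto.simps
      by (intro conjI exI[of _ ?D]) auto
  qed
qed

lemma graded_sqrt:
  assumes c: "c > 0" "\<forall>\<^sub>F e in at_right 0. \<forall>x\<in>J. c \<le> F e x" and F: "graded J 0 F"
  shows "graded J 0 (\<lambda>e x. sqrt (F e x))"
  unfolding graded_def
proof
  from graded_order_bound[OF F] obtain B where
    B: "\<forall>\<^sub>F e in at_right 0. \<forall>x\<in>J. \<bar>F e x\<bar> \<le> B * e ^ 0" by (auto simp: order_bound_def)
  have "\<forall>\<^sub>F e in at_right 0. \<forall>x\<in>J. \<bar>sqrt (F e x)\<bar> \<le> sqrt B * e ^ 0"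
    using B c(2) by eventually_elim (use c(1) in force)
  then have bd: "order_bound J 0 (\<lambda>e x. sqrt (F e x))" by (auto simp: order_bound_def)
  fix N show "graded_upto J N 0 (\<lambda>e x. sqrt (F e x))"
  proof (induction N)
    case 0
    show ?case using bd by simp
  next
    case (Suc N)
    from F have "graded_upto J (Suc N) 0 F" unfolding graded_def by blast
    then obtain F' where
      F': "\<forall>\<^sub>F e in at_right 0. \<forall>x\<in>J. (F e has_real_derivative F' e x) (at x)"
       "graded_upto J N 1 F'" by auto
    \<comment> \<open>F' / (2 sqrt F) is rewritten as F' sqrt F / (2 F): the square root then recurs
      as itself, and the other factor is the inverse of \<open>F\<close>, which is already known to
      be graded.\<close>
    let ?D = "\<lambda>e x. (1 / 2) * (F' e x * (sqrt (F e x) * inverse (F e x)))"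
    have "\<forall>\<^sub>F e in at_right 0. \<forall>x\<in>J.
        ((\<lambda>x. sqrt (F e x)) has_real_derivative ?D e x) (at x)"
      using F'(1) c(2)
    proof eventually_elim
      case (elim e)
      show ?case
      proof
        fix x assume x: "x \<in> J"
        with elim c(1) have "F e x > 0" by force
        with elim x show "((\<lambda>x. sqrt (F e x)) has_real_derivative ?D e x) (at x)"
          by (auto intro!: derivative_eq_intros simp: field_simps real_sqrt_mult_self power2_eq_square)
      qed
    qed
    moreover have "graded_upto J N (0 + (1 + (0 + 0))) ?D"
      using Suc.IH F'(2) graded_const[of J "1/2"] graded_inverse[OF c F]
      by (intro graded_upto_mult) (auto simp: graded_def)
    ultimately show ?case
      using bd unfolding graded_upto.simps
      by (intro conjI exI[of _ ?D]) auto
  qed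
qed

text \<open>The derivative F' / F involves no logarithm and is graded by the rules for products and
  inverses, so \<open>gradedI\<close> applies directly. Boundedness of ln F comes from c <= F <=
  B.\<close>

lemma graded_ln:
  assumes J: "open J" and c: "c > 0" "\<forall>\<^sub>F e in at_right 0. \<forall>x\<in>J. c \<le> F e x" and F: "graded J 0 F"
  shows "graded J 0 (\<lambda>e x. ln (F e x))"
proof (rule gradedI)
  from graded_order_bound[OF F] obtain B where
    B: "\<forall>\<^sub>F e in at_right 0. \<forall>x\<in>J. \<bar>F e x\<bar> \<le> B * e ^ 0" by (auto simp: order_bound_def)
  have "\<forall>\<^sub>F e in at_right 0. \<forall>x\<in>J. \<bar>ln (F e x)\<bar> \<le> (\<bar>ln c\<bar> + \<bar>ln B\<bar>) * e ^ 0"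
    using B c(2)
  proof eventually_elim
    case (elim e)
    show ?case
    proof
      fix x assume x: "x \<in> J"
      have "c \<le> F e x" "F e x \<le> B" using elim x by force+
      then have "ln c \<le> ln (F e x)" "ln (F e x) \<le> ln B" using c(1) by auto
      then show "\<bar>ln (F e x)\<bar> \<le> (\<bar>ln c\<bar> + \<bar>ln B\<bar>) * e ^ 0" by auto
    qed
  qed
  then show "order_bound J 0 (\<lambda>e x. ln (F e x))" unfolding order_bound_def by blast
  show "\<forall>\<^sub>F e in at_right 0. \<forall>x\<in>J.
     ((\<lambda>x. ln (F e x)) has_real_derivative deriv (F e) x * inverse (F e x)) (at x)"
    using graded_derivative(2)[OF J F] c(2)
  proof eventually_elim
    case (elim e)
    show ?case
    proof
      fix x assume x: "x \<in> J"
      with elim c(1) have "F e x > 0" by force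
      with elim x show "((\<lambda>x. ln (F e x)) has_real_derivative deriv (F e) x * inverse (F e x)) (at x)"
        by (auto intro!: derivative_eq_intros simp: divide_inverse)
    qed
  qed
  show "graded J (Suc 0) (\<lambda>e x. deriv (F e) x * inverse (F e x))"
    using graded_mult[OF graded_derivative(1)[OF J F] graded_inverse[OF c F]] by simp
qed

section \<open>Means along a segment\<close>

text \<open>The weight \<open>t ^ m\<close> counts factors \<open>t\<close>: one arises from the
  chain rule at each differentiation in \<open>x\<close>, and one in the second-order Taylor
  remainder. It is not normalised; its total mass is 1 / (m + 1).\<close>

definition ray_mean :: "nat \<Rightarrow> real \<Rightarrow> (real \<Rightarrow> real) \<Rightarrow> real \<Rightarrow> real" where
  "ray_mean m a f x = integral (cbox 0 1) (\<lambda>t. t ^ m * f (a + t * (x - a)))"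

lemma ray_in:
  assumes "convex J" "a \<in> J" "x \<in> J" "(t::real) \<in> cbox 0 1"
  shows "a + t * (x - a) \<in> J"
  using assms convexD_alt[of J a x t] by (auto simp: algebra_simps)

lemma DERIV_ray:
  fixes f :: "real \<Rightarrow> real"
  assumes "(f has_real_derivative D) (at (a + t * (x - a)))"
  shows "((\<lambda>t. f (a + t * (x - a))) has_real_derivative (x - a) * D) (at t within S)"
    and "((\<lambda>x. f (a + t * (x - a))) has_real_derivative t * D) (at x within S)"
proof -
  have "((\<lambda>t. a + t * (x - a)) has_real_derivative x - a) (at t within S)"
    "((\<lambda>x. a + t * (x - a)) has_real_derivative t) (at x within S)"
    by (auto intro!: derivative_eq_intros)
  then show "((\<lambda>t. f (a + t * (x - a))) has_real_derivative (x - a) * D) (at t within S)"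
    and "((\<lambda>x. f (a + t * (x - a))) has_real_derivative t * D) (at x within S)"
    using DERIV_chain2[where f = f and g = "\<lambda>t. a + t * (x - a)" and x = t, OF assms]
      DERIV_chain2[where f = f and g = "\<lambda>x. a + t * (x - a)" and x = x, OF assms]
    by (metis mult.commute)+
qed

lemma ray_mean_integrable:
  assumes "convex J" "a \<in> J" "x \<in> J" "continuous_on J f"
  shows "(\<lambda>t. t ^ m * f (a + t * (x - a))) integrable_on cbox (0::real) 1"
  by (intro integrable_continuous continuous_intros continuous_on_compose2[OF assms(4)])
    (use ray_in[OF assms(1-3)] in auto)

lemma ray_mean_bound:
  assumes "convex J" "a \<in> J" "x \<in> J" "continuous_on J f" and B: "\<And>y. y \<in> J \<Longrightarrow> \<bar>f y\<bar> \<le> B"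
  shows "\<bar>ray_mean m a f x\<bar> \<le> B"
proof -
  have "norm (ray_mean m a f x) \<le> B * measure lborel (cbox 0 (1::real))"
    unfolding ray_mean_def
  proof (rule has_integral_bound[OF _ integrable_integral[OF ray_mean_integrable[OF assms(1-4)]]])
    show "0 \<le> B" using B[OF assms(2)] by linarith
    fix t :: real assume t: "t \<in> cbox 0 1"
    then have "\<bar>t ^ m\<bar> * \<bar>f (a + t * (x - a))\<bar> \<le> 1 * B"
      using B[OF ray_in[OF assms(1-3) t]] by (intro mult_mono) (auto simp: power_le_one)
    then show "norm (t ^ m * f (a + t * (x - a))) \<le> B" by (simp add: abs_mult)
  qed
  then show ?thesis by simp
qed

lemma ray_mean_ge:
  assumes "convex J" "a \<in> J" "x \<in> J" "continuous_on J f" and c: "\<And>y. y \<in> J \<Longrightarrow> c \<le> f y"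
  shows "c / (m + 1) \<le> ray_mean m a f x"
proof -
  have "((\<lambda>t. t ^ m * c) has_integral c / (m + 1)) (cbox 0 (1::real))"
  proof -
    \<comment> \<open>For m = 0 the truncated exponent \<open>m - Suc 0\<close> is 0 instead of -1,
      but the coefficient \<open>real m\<close> annihilates the term; hence the case split.\<close>
    have pw: "y ^ m + real m * y ^ (m - Suc 0) * y = real (Suc m) * y ^ m" for y :: real
      by (cases m) (auto simp: algebra_simps)
    have "((\<lambda>t. t ^ m * c) has_integral 1 ^ (m + 1) * c / (m + 1) - 0 ^ (m + 1) * c / (m + 1)) {0..1}"
      by (rule fundamental_theorem_of_calculus)
        (auto intro!: derivative_eq_intros
          simp: has_real_derivative_iff_has_vector_derivative[symmetric] pw simp del: of_nat_Suc)
    then show ?thesis by simp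
  qed
  then have "c / (m + 1) \<le> integral (cbox 0 1) (\<lambda>t. t ^ m * f (a + t * (x - a)))"
    by (rule has_integral_le[OF _ integrable_integral[OF ray_mean_integrable[OF assms(1-4)]]])
      (use c ray_in[OF assms(1-3)] in \<open>auto intro!: mult_left_mono\<close>)
  then show ?thesis by (simp add: ray_mean_def add.commute)
qed

text \<open>Differentiation under the integral sign: the inner derivative \<open>t\<close> raises
  the weight exponent by one, so the result is again a mean of the same kind.\<close>

lemma ray_mean_derivative:
  assumes J: "open J" "convex J" "a \<in> J" "x \<in> J"
    and f: "\<And>y. y \<in> J \<Longrightarrow> (f has_real_derivative f' y) (at y)" and f': "continuous_on J f'"
  shows "(ray_mean m a f has_real_derivative ray_mean (Suc m) a f' x) (at x)"
proof -
  have cf: "continuous_on J f" using f by (meson DERIV_continuous_on has_field_derivative_at_within)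
  have "((\<lambda>x. integral (cbox 0 1) (\<lambda>t. t ^ m * f (a + t * (x - a)))) has_real_derivative
      integral (cbox 0 1) (\<lambda>t. t ^ Suc m * f' (a + t * (x - a)))) (at x within J)"
  proof (rule leibniz_rule_field_derivative)
    fix y t :: real assume y: "y \<in> J" "t \<in> cbox 0 1"
    show "((\<lambda>x. t ^ m * f (a + t * (x - a))) has_real_derivative
        t ^ Suc m * f' (a + t * (y - a))) (at y within J)"
      using DERIV_cmult[where c = "t ^ m", OF DERIV_ray(2)[OF f[OF ray_in[OF J(2,3) y]]]]
      by (simp add: mult_ac)
  next
    show "(\<lambda>t. t ^ m * f (a + t * (y - a))) integrable_on cbox 0 1" if "y \<in> J" for y
      using ray_mean_integrable[OF J(2,3) that cf] .
    show "continuous_on (J \<times> cbox 0 1) (\<lambda>(x, t). t ^ Suc m * f' (a + t * (x - a)))"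
      unfolding split_beta
      by (intro continuous_intros continuous_on_compose2[OF f'])
        (use ray_in[OF J(2,3)] in auto)
  qed (use J in auto)
  then show ?thesis using J by (simp add: ray_mean_def[abs_def] at_within_open[of x J])
qed

text \<open>The substitution y = a + t (x - a) in the fundamental theorem of calculus. Keeping the
  factor \<open>x - a\<close> instead of dividing by it covers x = a and x < a alike.\<close>

lemma ray_mean_fundamental:
  assumes J: "convex J" "a \<in> J" "x \<in> J"
    and f: "\<And>y. y \<in> J \<Longrightarrow> (f has_real_derivative f' y) (at y)"
  shows "(x - a) * ray_mean 0 a f' x = f x - f a"
proof -
  have "((\<lambda>t. (x - a) * f' (a + t * (x - a))) has_integral f (a + 1 * (x - a)) - f (a + 0 * (x - a))) {0..1}"
  proof (rule fundamental_theorem_of_calculus)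
    fix t :: real assume "t \<in> {0..1}"
    then have t: "t \<in> cbox 0 1" by simp
    show "((\<lambda>t. f (a + t * (x - a))) has_vector_derivative (x - a) * f' (a + t * (x - a)))
        (at t within {0..1})"
      unfolding has_real_derivative_iff_has_vector_derivative[symmetric]
      by (rule DERIV_ray(1)[OF f[OF ray_in[OF J t]]])
  qed simp
  then have "((\<lambda>t. (x - a) * f' (a + t * (x - a))) has_integral f x - f a) {0..1}" by simp
  from integral_unique[OF this] show ?thesis by (simp add: ray_mean_def)
qed

text \<open>One level is lost: estimating a mean requires a continuous integrand, and continuity is
  drawn from the next derivative. The base point may move with the parameter, because the bounds on
  \<open>F\<close> hold throughout \<open>J\<close>.\<close>

lemma graded_upto_ray_mean:
  assumes J: "open J" "convex J" and a: "\<forall>\<^sub>F e in at_right 0. a e \<in> J"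
  shows "graded_upto J (Suc N) k F \<Longrightarrow> graded_upto J N k (\<lambda>e. ray_mean m (a e) (F e))"
proof (induction N arbitrary: m k F)
  case (0 m k F)
  then obtain F' B where
    F': "\<forall>\<^sub>F e in at_right 0. \<forall>x\<in>J. (F e has_real_derivative F' e x) (at x)"
    and B: "\<forall>\<^sub>F e in at_right 0. \<forall>x\<in>J. \<bar>F e x\<bar> \<le> B * e ^ k" by (auto simp: order_bound_def)
  have "\<forall>\<^sub>F e in at_right 0. \<forall>x\<in>J. \<bar>ray_mean m (a e) (F e) x\<bar> \<le> B * e ^ k"
    using F' B a
  proof eventually_elim
    case (elim e)
    then have "continuous_on J (F e)" by (auto intro: DERIV_continuous_on DERIV_subset)
    with elim J show ?case by (auto intro!: ray_mean_bound[of J])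
  qed
  then show ?case by (auto simp: order_bound_def)
next
  case (Suc N m k F)
  then obtain F' where
    F': "\<forall>\<^sub>F e in at_right 0. \<forall>x\<in>J. (F e has_real_derivative F' e x) (at x)"
       "graded_upto J (Suc N) (Suc k) F'" by auto
  then obtain F'' where
    F'': "\<forall>\<^sub>F e in at_right 0. \<forall>x\<in>J. (F' e has_real_derivative F'' e x) (at x)" by auto
  have "\<forall>\<^sub>F e in at_right 0. \<forall>x\<in>J. (ray_mean m (a e) (F e) has_real_derivative
      ray_mean (Suc m) (a e) (F' e) x) (at x)"
    using F'(1) F'' a
  proof eventually_elim
    case (elim e)
    then have "continuous_on J (F' e)" by (auto intro: DERIV_continuous_on DERIV_subset)
    with elim J show ?case by (auto intro!: ray_mean_derivative[of J])
  qed
  moreover have "graded_upto J N (Suc k) (\<lambda>e. ray_mean (Suc m) (a e) (F' e))"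
    by (rule Suc.IH[OF F'(2)])
  \<comment> \<open>This uses the induction hypothesis for \<open>F\<close> itself, with its level
    lowered by one, and not for \<open>F'\<close>.\<close>
  moreover have "order_bound J k (\<lambda>e. ray_mean m (a e) (F e))"
    using Suc.IH[OF graded_upto_SucD[OF Suc.prems]] by (rule graded_upto_order_bound)
  ultimately show ?case unfolding graded_upto.simps
    by (intro conjI exI[of _ "\<lambda>e. ray_mean (Suc m) (a e) (F' e)"])
qed

lemma graded_ray_mean:
  "open J \<Longrightarrow> convex J \<Longrightarrow> \<forall>\<^sub>F e in at_right 0. a e \<in> J \<Longrightarrow> graded J k F \<Longrightarrow>
   graded J k (\<lambda>e. ray_mean m (a e) (F e))"
  by (auto simp: graded_def simp del: graded_upto.simps intro: graded_upto_ray_mean)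

section \<open>Smoothness of the cumulant generating function\<close>

text \<open>The counterpart of \<open>graded_upto\<close> for a single function, without estimates.
  As \<open>deriv\<close> returns a value even where no derivative exists, iterating it means
  something only after existence has been shown.\<close>

primrec differentiable_upto :: "nat \<Rightarrow> real set \<Rightarrow> (real \<Rightarrow> real) \<Rightarrow> bool" where
  "differentiable_upto 0 S f \<longleftrightarrow> True"
| "differentiable_upto (Suc n) S f \<longleftrightarrow>
     (\<exists>g. (\<forall>x\<in>S. (f has_real_derivative g x) (at x)) \<and> differentiable_upto n S g)"

lemma differentiable_upto_SucD: "differentiable_upto (Suc n) S f \<Longrightarrow> differentiable_upto n S f"
proof (induction n arbitrary: f)
  case (Suc n)
  from Suc.prems show ?case using Suc.IH by (subst differentiable_upto.simps(2)) auto
qed simp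

lemma differentiable_upto_cong:
  assumes "open S" "\<And>x. x \<in> S \<Longrightarrow> f x = g x" "differentiable_upto n S f"
  shows "differentiable_upto n S g"
proof (cases n)
  case (Suc m)
  with assms(3) obtain f' where "\<forall>x\<in>S. (f has_real_derivative f' x) (at x)"
    "differentiable_upto m S f'" by auto
  then have "\<forall>x\<in>S. (g has_real_derivative f' x) (at x)"
    using assms(1,2) by (blast intro: has_field_derivative_transform_within_open)
  with Suc \<open>differentiable_upto m S f'\<close> show ?thesis by auto
qed simp

lemma differentiable_upto_deriv:
  assumes "open S" "differentiable_upto (Suc n) S f"
  shows "differentiable_upto n S (deriv f)" "x \<in> S \<Longrightarrow> (f has_real_derivative deriv f x) (at x)"
proof -
  from assms obtain g where g: "\<forall>x\<in>S. (f has_real_derivative g x) (at x)"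
    "differentiable_upto n S g" by auto
  then have eq: "g x = deriv f x" if "x \<in> S" for x using that by (metis DERIV_imp_deriv)
  show "differentiable_upto n S (deriv f)"
    by (rule differentiable_upto_cong[OF assms(1) eq g(2)])
  show "x \<in> S \<Longrightarrow> (f has_real_derivative deriv f x) (at x)" using g(1) eq by auto
qed

lemma differentiable_upto_higher_deriv:
  assumes "open S" "x \<in> S"
  shows "differentiable_upto (Suc n) S f \<Longrightarrow>
    ((deriv ^^ n) f has_real_derivative (deriv ^^ Suc n) f x) (at x)"
proof (induction n arbitrary: f)
  case 0
  then show ?case using differentiable_upto_deriv(2)[OF assms(1) "0.prems" assms(2)] by simp
next
  case (Suc n)
  show ?case using Suc.IH[OF differentiable_upto_deriv(1)[OF assms(1) Suc.prems]]
    by (simp add: funpow_swap1)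
qed

lemma differentiable_upto_add:
  "differentiable_upto n S f \<Longrightarrow> differentiable_upto n S g \<Longrightarrow>
   differentiable_upto n S (\<lambda>x. f x + g x)"
proof (induction n arbitrary: f g)
  case (Suc n)
  then obtain f' g' where
    "\<forall>x\<in>S. (f has_real_derivative f' x) (at x)" "differentiable_upto n S f'"
    "\<forall>x\<in>S. (g has_real_derivative g' x) (at x)" "differentiable_upto n S g'" by auto
  then show ?case using Suc.IH[of f' g']
    by (auto intro!: exI[of _ "\<lambda>x. f' x + g' x"] derivative_eq_intros)
qed simp

lemma differentiable_upto_mult:
  "differentiable_upto n S f \<Longrightarrow> differentiable_upto n S g \<Longrightarrow>
   differentiable_upto n S (\<lambda>x. f x * g x)"
proof (induction n arbitrary: f g)
  case (Suc n)
  then obtain f' g' where f': "\<forall>x\<in>S. (f has_real_derivative f' x) (at x)" "differentiable_upto n S f'"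
    and g': "\<forall>x\<in>S. (g has_real_derivative g' x) (at x)" "differentiable_upto n S g'" by auto
  have "differentiable_upto n S (\<lambda>x. f' x * g x + f x * g' x)"
    using f' g' Suc.prems[THEN differentiable_upto_SucD]
    by (intro differentiable_upto_add Suc.IH)
  with f'(1) g'(1) show ?case
    by (auto intro!: exI[of _ "\<lambda>x. f' x * g x + f x * g' x"] derivative_eq_intros)
qed simp

lemma differentiable_upto_inverse:
  assumes "\<And>x. x \<in> S \<Longrightarrow> f x \<noteq> 0"
  shows "differentiable_upto n S f \<Longrightarrow> differentiable_upto n S (\<lambda>x. inverse (f x))"
proof (induction n)
  case (Suc n)
  then obtain f' where f': "\<forall>x\<in>S. (f has_real_derivative f' x) (at x)" "differentiable_upto n S f'"
    by auto
  have const: "differentiable_upto m S (\<lambda>x. c)" for m c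
  proof (induction m arbitrary: c)
    case (Suc m)
    then show ?case by (auto intro!: exI[of _ "\<lambda>x. 0"])
  qed simp
  let ?D = "\<lambda>x. (- 1) * (f' x * (inverse (f x) * inverse (f x)))"
  have "differentiable_upto n S ?D"
    using f' Suc.IH[OF differentiable_upto_SucD[OF Suc.prems]] const
    by (intro differentiable_upto_mult)
  moreover have "((\<lambda>x. inverse (f x)) has_real_derivative ?D x) (at x)" if "x \<in> S" for x
    using f'(1) assms[OF that] that by (auto intro!: derivative_eq_intros simp: field_simps)
  ultimately show ?case unfolding differentiable_upto.simps by (intro exI[of _ ?D]) blast
qed simp

section \<open>Domain and exponential moments of the measure\<close>

text \<open>For a <= t <= b, exp (t y) is at most exp (b y) if y >= 0 and at most exp (a y) if y <
  0, hence at most their sum.\<close>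

lemma convex_cgf_domain:
  assumes "real_distribution M"
  shows "convex (cgf_domain M)"
proof -
  interpret real_distribution M by fact
  show ?thesis unfolding is_interval_convex_1[symmetric] is_interval_1
  proof safe
    fix a b t :: real
    assume ab: "a \<in> cgf_domain M" "b \<in> cgf_domain M" "a \<le> t" "t \<le> b"
    have "integrable M (\<lambda>y. exp (t * y))"
    proof (rule Bochner_Integration.integrable_bound)
      show "integrable M (\<lambda>y. exp (a * y) + exp (b * y))" using ab by (auto simp: cgf_domain_def)
      have "exp (t * y) \<le> exp (a * y) + exp (b * y)" for y
      proof (cases "y \<ge> 0")
        case True
        then have "exp (t * y) \<le> exp (b * y)" using ab by (auto intro: mult_right_mono)
        then show ?thesis by (simp add: add_increasing)
      next
        case False
        then have "exp (t * y) \<le> exp (a * y)" using ab by (auto intro: mult_right_mono_neg)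
        then show ?thesis by (simp add: add_increasing2)
      qed
      then show "AE y in M. norm (exp (t * y)) \<le> norm (exp (a * y) + exp (b * y))"
        by (auto simp: abs_of_nonneg)
    qed simp
    then show "t \<in> cgf_domain M" by (simp add: cgf_domain_def)
  qed
qed

text \<open>Powers cost only an arbitrarily small exponential: apply u <= exp u to u = c |y| and
  take n-th powers.\<close>

lemma power_le_exp_abs:
  assumes "\<eta> > (0::real)"
  obtains C where "\<And>y::real. \<bar>y\<bar> ^ n \<le> C * exp (\<eta> * \<bar>y\<bar>)"
proof
  \<comment> \<open>Chosen so that n copies of \<open>c\<close> stay within \<open>\<eta>\<close>;
    the \<open>+ 1\<close> covers n = 0.\<close>
  define c where "c = \<eta> / (n + 1)"
  have c: "c > 0" "n * c \<le> \<eta>" using assms by (auto simp: c_def field_simps)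
  fix y :: real
  have "c * \<bar>y\<bar> \<le> exp (c * \<bar>y\<bar>)" using exp_ge_add_one_self[of "c * \<bar>y\<bar>"] by linarith
  then have "(c * \<bar>y\<bar>) ^ n \<le> exp (c * \<bar>y\<bar>) ^ n" using c by (intro power_mono) auto
  also have "\<dots> = exp (n * c * \<bar>y\<bar>)" by (simp add: exp_of_nat_mult[symmetric] mult.assoc)
  also have "\<dots> \<le> exp (\<eta> * \<bar>y\<bar>)" using c by (auto intro: mult_right_mono)
  finally show "\<bar>y\<bar> ^ n \<le> inverse (c ^ n) * exp (\<eta> * \<bar>y\<bar>)"
    using c by (simp add: power_mult_distrib field_simps)
qed

lemma cgf_open_domain_ball:
  assumes "\<theta> \<in> cgf_open_domain M"
  obtains \<eta> where "\<eta> > 0" "\<And>t. \<bar>t - \<theta>\<bar> \<le> \<eta> \<Longrightarrow> t \<in> cgf_domain M"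
proof -
  from assms obtain \<eta> where "\<eta> > 0" "cball \<theta> \<eta> \<subseteq> cgf_domain M"
    unfolding cgf_open_domain_def mem_interior_cball by blast
  then show ?thesis by (intro that[of \<eta>]) (auto simp: dist_real_def abs_minus_commute)
qed

text \<open>A point of the open domain has room on both sides. Half of it absorbs the power of |y|;
  the other half remains as the extra weight that later dominates difference quotients.\<close>

lemma integrable_moment:
  assumes M: "real_distribution M" and "\<theta> \<in> cgf_open_domain M"
  obtains \<eta> where "\<eta> > 0"
    "\<And>n. integrable M (\<lambda>y. \<bar>y\<bar> ^ n * exp (\<theta> * y + \<eta> * \<bar>y\<bar>))"
proof -
  interpret real_distribution M by fact
  from cgf_open_domain_ball[OF assms(2)] obtain \<eta>
    where \<eta>: "\<eta> > 0" "\<And>t. \<bar>t - \<theta>\<bar> \<le> \<eta> \<Longrightarrow> t \<in> cgf_domain M" by blast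
  show ?thesis
  proof (rule that[of "\<eta> / 2"])
    fix n
    obtain C where C: "\<And>y::real. \<bar>y\<bar> ^ n \<le> C * exp (\<eta> / 2 * \<bar>y\<bar>)"
      using power_le_exp_abs[of "\<eta> / 2" n] \<eta>(1) by auto
    have "0 \<le> C" using order_trans[OF _ C[of 0]] by simp
    show "integrable M (\<lambda>y. \<bar>y\<bar> ^ n * exp (\<theta> * y + \<eta> / 2 * \<bar>y\<bar>))"
    proof (rule Bochner_Integration.integrable_bound)
      have "\<theta> + \<eta> \<in> cgf_domain M" "\<theta> - \<eta> \<in> cgf_domain M"
        using \<eta>(1) by (auto intro!: \<eta>(2))
      then show "integrable M (\<lambda>y. C * (exp ((\<theta> + \<eta>) * y) + exp ((\<theta> - \<eta>) * y)))"
        by (auto simp: cgf_domain_def)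
      have "\<bar>y\<bar> ^ n * exp (\<theta> * y + \<eta> / 2 * \<bar>y\<bar>) \<le>
          C * (exp ((\<theta> + \<eta>) * y) + exp ((\<theta> - \<eta>) * y))" for y
      proof -
        have "\<bar>y\<bar> ^ n * exp (\<theta> * y + \<eta> / 2 * \<bar>y\<bar>) \<le>
            C * exp (\<eta> / 2 * \<bar>y\<bar>) * exp (\<theta> * y + \<eta> / 2 * \<bar>y\<bar>)"
          using C by (intro mult_right_mono) auto
        also have "\<dots> = C * exp (\<theta> * y + \<eta> * \<bar>y\<bar>)"
          by (simp add: mult.assoc flip: exp_add)
        also have "exp (\<theta> * y + \<eta> * \<bar>y\<bar>) \<le> exp ((\<theta> + \<eta>) * y) + exp ((\<theta> - \<eta>) * y)"
          by (cases "y \<ge> 0") (auto simp: algebra_simps add_increasing add_increasing2)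
        finally show ?thesis using \<open>0 \<le> C\<close> by (simp add: mult_left_mono)
      qed
      then show "AE y in M. norm (\<bar>y\<bar> ^ n * exp (\<theta> * y + \<eta> / 2 * \<bar>y\<bar>)) \<le>
          norm (C * (exp ((\<theta> + \<eta>) * y) + exp ((\<theta> - \<eta>) * y)))"
        using \<open>0 \<le> C\<close> by (auto simp: abs_mult)
    qed simp
  qed (use \<eta> in simp)
qed

definition exp_moment :: "real measure \<Rightarrow> nat \<Rightarrow> real \<Rightarrow> real" where
  "exp_moment M n \<theta> = (LINT y|M. y ^ n * exp (\<theta> * y))"

lemma exp_remainder_le:
  fixes u :: real
  shows "\<bar>exp u - 1 - u\<bar> \<le> u\<^sup>2 * exp \<bar>u\<bar>"
proof -
  obtain t where t: "\<bar>t\<bar> \<le> \<bar>u\<bar>" "exp u = (\<Sum>m<2. u ^ m / fact m) + exp t / fact 2 * u ^ 2"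
    using Maclaurin_exp_le[of u 2] by blast
  then have "exp u - 1 - u = exp t / 2 * u\<^sup>2" by (simp add: numeral_2_eq_2)
  also have "\<bar>\<dots>\<bar> \<le> exp \<bar>u\<bar> * u\<^sup>2"
    unfolding abs_mult using t(1) order_trans[OF _ exp_le_cancel_iff[THEN iffD2, of t "\<bar>u\<bar>"], of "exp t / 2"]
    by (intro mult_mono) auto
  finally show ?thesis by (simp add: mult.commute)
qed

text \<open>Multiplied by h, the error of the difference quotient has the integrand y^n exp
  (\<theta> y) (exp (h y) - 1 - h y). The Taylor bound (h y)^2 exp |h y| supplies the factor h^2
  and, for |h| <= \<eta>, an integrable dominating function.\<close>

lemma exp_moment_derivative:
  assumes M: "real_distribution M" and \<theta>: "\<theta> \<in> cgf_open_domain M"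
  shows "(exp_moment M n has_real_derivative exp_moment M (Suc n) \<theta>) (at \<theta>)"
proof -
  interpret real_distribution M by fact
  from integrable_moment[OF M \<theta>] obtain \<eta> where \<eta>: "\<eta> > 0"
    "\<And>n. integrable M (\<lambda>y. \<bar>y\<bar> ^ n * exp (\<theta> * y + \<eta> * \<bar>y\<bar>))" by blast
  \<comment> \<open>The integral of that dominating function: two extra powers of |y| from the
    quadratic remainder, and the weight from exp |h y|.\<close>
  define A where "A = (LINT y|M. \<bar>y\<bar> ^ (n + 2) * exp (\<theta> * y + \<eta> * \<bar>y\<bar>))"
  have int: "integrable M (\<lambda>y. y ^ m * exp ((\<theta> + h) * y))" if "\<bar>h\<bar> \<le> \<eta>" for h m
  proof (rule Bochner_Integration.integrable_bound[OF \<eta>(2)[of m]])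
    have "h * y \<le> \<eta> * \<bar>y\<bar>" for y
      using mult_right_mono[OF that abs_ge_zero, of y] by (simp flip: abs_mult)
    then show "AE y in M. norm (y ^ m * exp ((\<theta> + h) * y)) \<le>
        norm (\<bar>y\<bar> ^ m * exp (\<theta> * y + \<eta> * \<bar>y\<bar>))"
      by (auto simp: abs_mult power_abs algebra_simps intro!: mult_left_mono)
  qed simp
  have bound: "\<bar>(exp_moment M n (\<theta> + h) - exp_moment M n \<theta>) / h - exp_moment M (Suc n) \<theta>\<bar> \<le> A * \<bar>h\<bar>"
    if h: "h \<noteq> 0" "\<bar>h\<bar> \<le> \<eta>" for h
  proof -
    let ?R = "\<lambda>y. y ^ n * exp ((\<theta> + h) * y) - y ^ n * exp (\<theta> * y) - h * (y ^ Suc n * exp (\<theta> * y))"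
    have ints: "integrable M (\<lambda>y. y ^ n * exp ((\<theta> + h) * y))" "integrable M (\<lambda>y. y ^ n * exp (\<theta> * y))"
      "integrable M (\<lambda>y. y ^ Suc n * exp (\<theta> * y))"
      using int[OF h(2)] int[of 0 n] int[of 0 "Suc n"] \<eta>(1) by auto
    have eq: "exp_moment M n (\<theta> + h) - exp_moment M n \<theta> - h * exp_moment M (Suc n) \<theta> = (LINT y|M. ?R y)"
      unfolding exp_moment_def using ints by (simp del: power_Suc)
    have le: "\<bar>LINT y|M. ?R y\<bar> \<le> (LINT y|M. h\<^sup>2 * (\<bar>y\<bar> ^ (n + 2) * exp (\<theta> * y + \<eta> * \<bar>y\<bar>)))"
    proof (rule integral_abs_bound_integral)
      show "integrable M ?R" using ints by (intro Bochner_Integration.integrable_diff) auto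
      show "integrable M (\<lambda>y. h\<^sup>2 * (\<bar>y\<bar> ^ (n + 2) * exp (\<theta> * y + \<eta> * \<bar>y\<bar>)))"
        by (rule integrable_mult_right, rule \<eta>(2))
      fix y
      have R: "?R y = y ^ n * exp (\<theta> * y) * (exp (h * y) - 1 - h * y)"
        by (simp add: algebra_simps exp_add)
      have "\<bar>?R y\<bar> \<le> \<bar>y\<bar> ^ n * exp (\<theta> * y) * ((h * y)\<^sup>2 * exp \<bar>h * y\<bar>)"
        unfolding R abs_mult using exp_remainder_le[of "h * y"]
        by (intro mult_mono) (auto simp: power_abs abs_mult)
      also have "\<dots> \<le> \<bar>y\<bar> ^ n * exp (\<theta> * y) * ((h * y)\<^sup>2 * exp (\<eta> * \<bar>y\<bar>))"
        using h by (intro mult_left_mono) (auto simp: abs_mult intro!: mult_right_mono)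
      also have "\<dots> = h\<^sup>2 * (\<bar>y\<bar> ^ (n + 2) * exp (\<theta> * y + \<eta> * \<bar>y\<bar>))"
        by (simp add: power_add exp_add power_mult_distrib power2_eq_square mult_ac)
      finally show "\<bar>?R y\<bar> \<le> h\<^sup>2 * (\<bar>y\<bar> ^ (n + 2) * exp (\<theta> * y + \<eta> * \<bar>y\<bar>))" .
    qed
    have *: "\<bar>exp_moment M n (\<theta> + h) - exp_moment M n \<theta> - h * exp_moment M (Suc n) \<theta>\<bar> \<le> h\<^sup>2 * A"
      using le unfolding eq A_def integral_mult_right_zero .
    have "\<bar>(exp_moment M n (\<theta> + h) - exp_moment M n \<theta>) / h - exp_moment M (Suc n) \<theta>\<bar> =
        \<bar>exp_moment M n (\<theta> + h) - exp_moment M n \<theta> - h * exp_moment M (Suc n) \<theta>\<bar> / \<bar>h\<bar>"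
    proof -
      have "X / h - E = (X - h * E) / h" for X E using h by (simp add: field_simps)
      then show ?thesis by (simp only: abs_divide)
    qed
    also have "\<dots> \<le> h\<^sup>2 * A / \<bar>h\<bar>" using * by (intro divide_right_mono) auto
    also have "\<dots> = A * \<bar>h\<bar>"
    proof -
      have "a * a * A / a = A * a" if "a \<noteq> 0" for a :: real using that by simp
      from this[of "\<bar>h\<bar>"] h show ?thesis by (simp add: power2_eq_square)
    qed
    finally show ?thesis .
  qed
  have "((\<lambda>h. (exp_moment M n (\<theta> + h) - exp_moment M n \<theta>) / h - exp_moment M (Suc n) \<theta>) \<longlongrightarrow> 0) (at 0)"
  proof (rule Lim_null_comparison)
    show "\<forall>\<^sub>F h in at 0. norm ((exp_moment M n (\<theta> + h) - exp_moment M n \<theta>) / h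
        - exp_moment M (Suc n) \<theta>) \<le> A * \<bar>h\<bar>"
      unfolding eventually_at using bound \<eta>(1)
      by (intro exI[of _ \<eta>]) (auto simp: dist_real_def)
    show "((\<lambda>h. A * \<bar>h\<bar>) \<longlongrightarrow> 0) (at 0)" by (auto intro!: tendsto_eq_intros)
  qed
  then show ?thesis unfolding DERIV_def by (rule LIM_zero_cancel)
qed

text \<open>A nonnegative integrable function with integral 0 vanishes almost everywhere; an
  exponential vanishes nowhere, and a probability measure is not null.\<close>

lemma exp_moment_0_pos:
  assumes M: "real_distribution M" and \<theta>: "\<theta> \<in> cgf_domain M"
  shows "exp_moment M 0 \<theta> > 0"
proof -
  interpret real_distribution M by fact
  have int: "integrable M (\<lambda>y. exp (\<theta> * y))" using \<theta> by (simp add: cgf_domain_def)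
  have "\<not> (AE y in M. exp (\<theta> * y) = 0)" by simp
  then have "(LINT y|M. exp (\<theta> * y)) \<noteq> 0"
    using integral_nonneg_eq_0_iff_AE[OF int] by auto
  moreover have "(LINT y|M. exp (\<theta> * y)) \<ge> 0" by (rule Bochner_Integration.integral_nonneg) simp
  ultimately show ?thesis unfolding exp_moment_def power_0 mult_1 by linarith
qed

lemma cgf_eq_ln_exp_moment: "cgf M = (\<lambda>\<theta>. ln (exp_moment M 0 \<theta>))"
  by (auto simp: cgf_def exp_moment_def)

lemma open_cgf_open_domain: "open (cgf_open_domain M)"
  by (simp add: cgf_open_domain_def)

lemma cgf_derivative:
  assumes M: "real_distribution M" and \<theta>: "\<theta> \<in> cgf_open_domain M"
  shows "(cgf M has_real_derivative exp_moment M 1 \<theta> * inverse (exp_moment M 0 \<theta>)) (at \<theta>)"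
proof -
  have "exp_moment M 0 \<theta> > 0"
    using exp_moment_0_pos[OF M] \<theta> interior_subset by (auto simp: cgf_open_domain_def)
  then show ?thesis unfolding cgf_eq_ln_exp_moment
    using exp_moment_derivative[OF assms, of 0]
    by (auto intro!: derivative_eq_intros simp: divide_inverse)
qed

text \<open>K' is the first exponential moment divided by the zeroth, which is positive, and
  differentiating a moment just raises its index. Smoothness follows from closure under products and
  inverses.\<close>

lemma cgf_higher_derivative:
  assumes M: "real_distribution M" and \<theta>: "\<theta> \<in> cgf_open_domain M"
  shows "((deriv ^^ n) (cgf M) has_real_derivative (deriv ^^ Suc n) (cgf M) \<theta>) (at \<theta>)"
proof (rule differentiable_upto_higher_deriv[OF open_cgf_open_domain \<theta>])
  let ?O = "cgf_open_domain M"
  have mom: "differentiable_upto N ?O (exp_moment M k)" for N k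
    by (induction N arbitrary: k) (use exp_moment_derivative[OF M] in auto)
  have "exp_moment M 0 t \<noteq> 0" if "t \<in> ?O" for t
    using exp_moment_0_pos[OF M, of t] that interior_subset by (force simp: cgf_open_domain_def)
  then have "differentiable_upto n ?O (\<lambda>t. exp_moment M 1 t * inverse (exp_moment M 0 t))" (is "differentiable_upto n ?O ?K")
    by (intro differentiable_upto_mult differentiable_upto_inverse mom)
  then show "differentiable_upto (Suc n) ?O (cgf M)"
    using cgf_derivative[OF M] unfolding differentiable_upto.simps by (intro exI[of _ ?K]) auto
qed

lemma cgf_at_0:
  assumes M: "real_distribution M"
  shows "cgf M 0 = 0" "0 \<in> cgf_open_domain M \<Longrightarrow> deriv (cgf M) 0 = (LINT y|M. y)"
proof -
  interpret real_distribution M by fact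
  show "cgf M 0 = 0" by (simp add: cgf_def prob_space[unfolded space_eq_univ])
  show "deriv (cgf M) 0 = (LINT y|M. y)" if "0 \<in> cgf_open_domain M"
    using DERIV_imp_deriv[OF cgf_derivative[OF M that]] by (simp add: exp_moment_def prob_space[unfolded space_eq_univ])
qed

section \<open>The map to the saddlepoint coordinate\<close>

lemma convex_cgf_open_domain:
  "real_distribution M \<Longrightarrow> convex (cgf_open_domain M)"
  by (simp add: cgf_open_domain_def convex_interior convex_cgf_domain)

lemma deriv_cgf_strict_mono:
  assumes M: "real_distribution M"
    and pos: "\<And>\<theta>. \<theta> \<in> cgf_open_domain M \<Longrightarrow> (deriv ^^ 2) (cgf M) \<theta> > 0"
    and ab: "a \<in> cgf_open_domain M" "b \<in> cgf_open_domain M" "a < b"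
  shows "deriv (cgf M) a < deriv (cgf M) b"
proof (rule DERIV_pos_imp_increasing[OF ab(3)])
  fix t assume "a \<le> t" "t \<le> b"
  then have t: "t \<in> cgf_open_domain M"
    using ab convex_cgf_open_domain[OF M] by (meson is_interval_1 is_interval_convex_1)
  show "\<exists>y. (deriv (cgf M) has_real_derivative y) (at t) \<and> y > 0"
    using cgf_higher_derivative[OF M t, of 1] pos[OF t] by (auto simp: numeral_2_eq_2)
qed

text \<open>Strict monotonicity of K' gives the uniqueness that the definite description in
  \<open>saddlepoint\<close> requires.\<close>

lemma saddlepoint_eqI:
  assumes M: "real_distribution M"
    and pos: "\<And>\<theta>. \<theta> \<in> cgf_open_domain M \<Longrightarrow> (deriv ^^ 2) (cgf M) \<theta> > 0"
    and s: "s \<in> cgf_open_domain M" "deriv (cgf M) s = x"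
  shows "saddlepoint M x = s"
  unfolding saddlepoint_def
proof (rule the_equality)
  fix t assume "t \<in> cgf_open_domain M \<and> deriv (cgf M) t = x"
  then show "t = s"
    using deriv_cgf_strict_mono[OF M pos, of t s] deriv_cgf_strict_mono[OF M pos, of s t] s
    by (cases t s rule: linorder_cases) auto
qed (use s in simp)

lemma w_map_eq_w_hat_at_saddlepoint: "w_map M x (saddlepoint M x) = w_hat M x"
  by (simp add: w_map_def Let_def)

lemma w_map_at_0:
  assumes "real_distribution M" "saddlepoint M x \<noteq> 0"
  shows "w_map M x 0 = 0"
proof -
  define s where "s = saddlepoint M x"
  have "2 * ((cgf M 0 - x * 0) - (cgf M s - x * s)) = 2 * (x * s - cgf M s)"
    using cgf_at_0(1)[OF assms(1)] by simp
  \<comment> \<open>As \<open>sgn1 0\<close> is 1, reflection changes the sign only for a nonzero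
    argument.\<close>
  moreover have "sgn1 (0 - s) = - sgn1 s"
    using assms(2) by (simp add: sgn1_def s_def)
  ultimately show ?thesis by (simp only: w_map_def w_hat_def Let_def flip: s_def)
qed

text \<open>\<open>theta_map\<close> inverts over the whole open domain, so injectivity is needed
  there and not merely near s. K - x * id decreases to the left of s and increases to the right;
  hence the signed root increases on either side, and its sign separates the sides.\<close>

lemma w_map_inj:
  assumes M: "real_distribution M"
    and pos: "\<And>\<theta>. \<theta> \<in> cgf_open_domain M \<Longrightarrow> (deriv ^^ 2) (cgf M) \<theta> > 0"
    and s: "saddlepoint M x = s" "s \<in> cgf_open_domain M" "deriv (cgf M) s = x"
  shows "inj_on (w_map M x) (cgf_open_domain M)"
proof (rule linorder_inj_onI)
  define f where "f t = cgf M t - x * t" for t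
  have Df: "(f has_real_derivative deriv (cgf M) t - x) (at t)" if "t \<in> cgf_open_domain M" for t
    unfolding f_def using cgf_higher_derivative[OF M that, of 0]
    by (auto intro!: derivative_eq_intros)
  have seg: "t \<in> cgf_open_domain M"
    if "a \<in> cgf_open_domain M" "b \<in> cgf_open_domain M" "a \<le> t" "t \<le> b" for a b t
    using that convex_cgf_open_domain[OF M] by (meson is_interval_1 is_interval_convex_1)
  have cont: "continuous_on {a..b} f" if "a \<in> cgf_open_domain M" "b \<in> cgf_open_domain M" for a b
    using Df seg[OF that] by (auto intro!: DERIV_atLeastAtMost_imp_continuous_on)
  have right: "f a < f b" if ab: "a \<in> cgf_open_domain M" "b \<in> cgf_open_domain M" "s \<le> a" "a < b" for a b
  proof (rule DERIV_pos_imp_increasing_open[OF ab(4) _ cont[OF ab(1,2)]])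
    fix t assume "a < t" "t < b"
    then show "\<exists>y. (f has_real_derivative y) (at t) \<and> y > 0"
      using Df[of t] seg[OF ab(1,2), of t] deriv_cgf_strict_mono[OF M pos s(2), of t] s(3) ab(3) by force
  qed
  have left: "f a > f b" if ab: "a \<in> cgf_open_domain M" "b \<in> cgf_open_domain M" "b \<le> s" "a < b" for a b
  proof (rule DERIV_neg_imp_decreasing_open[OF ab(4) _ cont[OF ab(1,2)]])
    fix t assume "a < t" "t < b"
    then show "\<exists>y. (f has_real_derivative y) (at t) \<and> y < 0"
      using Df[of t] seg[OF ab(1,2), of t] deriv_cgf_strict_mono[OF M pos _ s(2), of t] s(3) ab(3) by force
  qed
  have w: "w_map M x t = w_hat M x + sgn1 (t - s) * sqrt (2 * (f t - f s))" for t
    by (simp add: w_map_def f_def Let_def s(1))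
  fix a b assume ab: "a < b" "a \<in> cgf_open_domain M" "b \<in> cgf_open_domain M"
  consider "s \<le> a" | "b \<le> s" | "a < s" "s < b" by linarith
  then have "w_map M x a < w_map M x b"
  proof cases
    case 1
    then show ?thesis using right[OF ab(2,3) 1 ab(1)] ab(1) by (simp add: w sgn1_def)
  next
    case 2
    then show ?thesis using left[OF ab(2,3) 2 ab(1)] ab(1) by (auto simp add: w sgn1_def)
  next
    case 3
    then have "f a > f s" "f b > f s" using right[OF s(2) ab(3)] left[OF ab(2) s(2)] by auto
    then have "- sqrt (2 * (f a - f s)) < 0" "0 < sqrt (2 * (f b - f s))" by simp_all
    then have "- sqrt (2 * (f a - f s)) < sqrt (2 * (f b - f s))" by linarith
    with 3 show ?thesis unfolding w sgn1_def by simp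
  qed
  then show "w_map M x a \<noteq> w_map M x b" by simp
qed auto

text \<open>Two applications of the fundamental theorem along the segment from s give K' - x = (t -
  s) r and f - f(s) = (t - s)^2 q. As \<open>sgn1 (t - s)\<close> times |t - s| is t - s, the kink
  of the root disappears. The second identity comes from differentiating f - f(s) and cancelling t -
  s.\<close>

lemma w_map_ray_mean:
  assumes M: "real_distribution M"
    and J: "open J" "convex J" "J \<subseteq> cgf_open_domain M"
    and s: "saddlepoint M x = s" "s \<in> J" "deriv (cgf M) s = x" and \<theta>: "\<theta> \<in> J"
  defines "r \<equiv> ray_mean 0 s ((deriv ^^ 2) (cgf M))"
  defines "q \<equiv> ray_mean 1 s r"
  assumes q: "q \<theta> > 0" and q': "(q has_real_derivative q') (at \<theta>)"
  shows "w_map M x \<theta> = w_hat M x + (\<theta> - s) * sqrt (2 * q \<theta>)"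
    and "2 * q \<theta> + (\<theta> - s) * q' = r \<theta>"
proof -
  define f where "f t = cgf M t - x * t" for t
  have Df: "(f has_real_derivative deriv (cgf M) t - x) (at t)" if "t \<in> J" for t
    unfolding f_def using cgf_higher_derivative[OF M subsetD[OF J(3) that], of 0]
    by (auto intro!: derivative_eq_intros)
  have r: "(t - s) * r t = deriv (cgf M) t - x" if "t \<in> J" for t
    unfolding r_def s(3)[symmetric]
  proof (rule ray_mean_fundamental[OF J(2) s(2) that])
    fix y assume "y \<in> J"
    then show "(deriv (cgf M) has_real_derivative (deriv ^^ 2) (cgf M) y) (at y)"
      using cgf_higher_derivative[OF M subsetD[OF J(3)], of y 1] by (simp add: numeral_2_eq_2)
  qed
  have f_eq: "f t - f s = (t - s)\<^sup>2 * q t" if t: "t \<in> J" for t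
  proof -
    have "f t - f s = (t - s) * ray_mean 0 s (\<lambda>t. deriv (cgf M) t - x) t"
      using ray_mean_fundamental[OF J(2) s(2) t Df] by simp
    \<comment> \<open>At s + u (t - s) the identity for r yields the factor u (t - s); its
      \<open>u\<close> becomes the weight in \<open>q\<close>.\<close>
    also have "ray_mean 0 s (\<lambda>t. deriv (cgf M) t - x) t =
        integral (cbox 0 1) (\<lambda>u. (t - s) * (u ^ 1 * r (s + u * (t - s))))"
      unfolding ray_mean_def
    proof (rule integral_cong)
      fix u :: real assume "u \<in> cbox 0 1"
      from r[OF ray_in[OF J(2) s(2) t this]]
      show "u ^ 0 * (deriv (cgf M) (s + u * (t - s)) - x) = (t - s) * (u ^ 1 * r (s + u * (t - s)))"
        by (simp add: mult_ac)
    qed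
    also have "\<dots> = (t - s) * ray_mean 1 s r t"
      unfolding ray_mean_def by (rule integral_mult_right)
    finally show ?thesis by (simp add: q_def power2_eq_square)
  qed
  have "w_map M x \<theta> = w_hat M x + sgn1 (\<theta> - s) * sqrt (2 * (f \<theta> - f s))"
    by (simp add: w_map_def f_def Let_def s(1))
  also have "sqrt (2 * (f \<theta> - f s)) = \<bar>\<theta> - s\<bar> * sqrt (2 * q \<theta>)"
    using f_eq[OF \<theta>] by (simp add: real_sqrt_mult)
  finally show "w_map M x \<theta> = w_hat M x + (\<theta> - s) * sqrt (2 * q \<theta>)"
    by (auto simp: sgn1_def)
  show "2 * q \<theta> + (\<theta> - s) * q' = r \<theta>"
  proof (cases "\<theta> = s")
    case True
    \<comment> \<open>At t = s nothing can be cancelled, so \<open>q s\<close> is computed: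
      \<open>r s\<close> times the integral of t over [0, 1].\<close>
    have "(\<lambda>t::real. t ^ 1 * r s) = (\<lambda>t. r s * t)" by auto
    moreover have "integral {0..1::real} (\<lambda>t. t) = 1 / 2"
      using ident_has_integral[of 0 "1::real"] by (simp add: integral_unique)
    ultimately have "q s = r s / 2"
      by (simp add: q_def ray_mean_def)
    then show ?thesis using True by simp
  next
    case False
    have "((\<lambda>t. f s + (t - s)\<^sup>2 * q t) has_real_derivative
        2 * (\<theta> - s) * q \<theta> + (\<theta> - s)\<^sup>2 * q') (at \<theta>)"
      using q' by (auto intro!: derivative_eq_intros)
    then have "(f has_real_derivative 2 * (\<theta> - s) * q \<theta> + (\<theta> - s)\<^sup>2 * q') (at \<theta>)"
      by (rule has_field_derivative_transform_within_open[OF _ J(1) \<theta>]) (use f_eq in force)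
    from DERIV_unique[OF this Df[OF \<theta>]] r[OF \<theta>]
    have "(\<theta> - s) * (2 * q \<theta> + (\<theta> - s) * q') = (\<theta> - s) * r \<theta>"
      by (simp add: algebra_simps power2_eq_square)
    with False show ?thesis by simp
  qed
qed

text \<open>The product rule gives (2 q + (t - s) q') / sqrt (2 q), whose numerator is r.
  Eliminating q' matters: r inherits a positive lower bound from K'', whereas (t - s) q' has no
  known sign.\<close>

lemma w_map_derivative:
  assumes M: "real_distribution M"
    and J: "open J" "convex J" "J \<subseteq> cgf_open_domain M"
    and s: "saddlepoint M x = s" "s \<in> J" "deriv (cgf M) s = x" and \<theta>: "\<theta> \<in> J"
  defines "r \<equiv> ray_mean 0 s ((deriv ^^ 2) (cgf M))"
  defines "q \<equiv> ray_mean 1 s r"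
  assumes q: "\<And>t. t \<in> J \<Longrightarrow> q t > 0" and q': "\<And>t. t \<in> J \<Longrightarrow> (q has_real_derivative q' t) (at t)"
  shows "(w_map M x has_real_derivative r \<theta> * inverse (sqrt (2 * q \<theta>))) (at \<theta>)"
proof -
  have w: "w_map M x t = w_hat M x + (t - s) * sqrt (2 * q t)"
    "2 * q t + (t - s) * q' t = r t" if "t \<in> J" for t
    using w_map_ray_mean[OF M J s that, of "q' t"] q[OF that] q'[OF that]
    unfolding q_def r_def by blast+
  have nz: "sqrt (2 * q \<theta>) \<noteq> 0" using q[OF \<theta>] by simp
  have sq: "sqrt (2 * q \<theta>) * sqrt (2 * q \<theta>) = 2 * q \<theta>" using q[OF \<theta>] by simp
  have "((\<lambda>t. w_hat M x + (t - s) * sqrt (2 * q t)) has_real_derivative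
      sqrt (2 * q \<theta>) + (\<theta> - s) * (q' \<theta> * inverse (sqrt (2 * q \<theta>)))) (at \<theta>)"
  proof (rule DERIV_cong[OF DERIV_add[OF DERIV_const DERIV_mult[OF DERIV_diff[OF DERIV_ident DERIV_const]
          DERIV_chain2[OF DERIV_real_sqrt DERIV_cmult[OF q'[OF \<theta>]]]]]])
    show "2 * q \<theta> > 0" using q[OF \<theta>] by simp
  qed simp
  moreover have "sqrt (2 * q \<theta>) + (\<theta> - s) * (q' \<theta> * inverse (sqrt (2 * q \<theta>))) =
      r \<theta> * inverse (sqrt (2 * q \<theta>))"
  proof -
    have "z + a * (b * inverse z) = (z * z + a * b) * inverse z" if "z \<noteq> 0" for z a b :: real
      using that by (simp add: field_simps)
    from this[OF nz, of "\<theta> - s" "q' \<theta>"] show ?thesis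
      unfolding sq w(2)[OF \<theta>] .
  qed
  ultimately have "((\<lambda>t. w_hat M x + (t - s) * sqrt (2 * q t)) has_real_derivative
      r \<theta> * inverse (sqrt (2 * q \<theta>))) (at \<theta>)" by (simp only:)
  then show ?thesis
  proof (rule has_field_derivative_transform_within_open[OF _ J(1) \<theta>])
    fix t assume t: "t \<in> J"
    show "w_hat M x + (t - s) * sqrt (2 * q t) = w_map M x t"
      using w(1)[OF t] by (rule sym)
  qed
qed

section \<open>Derivatives with respect to w, computed in the variable t\<close>

text \<open>The chain rule d/dw = (1 / W') d/dt. By invariance of domain the image of
  \<open>S\<close> is open, so the values of \<open>g\<close> along \<open>W\<close> determine
  \<open>g\<close> on a neighbourhood of \<open>W \<theta>\<close>, where it is \<open>E\<close>
  composed with the inverse of \<open>W\<close>.\<close>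

lemma deriv_along_inverse:
  fixes W :: "real \<Rightarrow> real"
  assumes S: "open S" "inj_on W S" "\<theta> \<in> S"
    and W: "\<And>t. t \<in> S \<Longrightarrow> (W has_real_derivative u t) (at t)" and u: "u \<theta> \<noteq> 0"
    and g: "\<And>t. t \<in> S \<Longrightarrow> g (W t) = E t" and E: "(E has_real_derivative D) (at \<theta>)"
  shows "deriv g (W \<theta>) = D * inverse (u \<theta>)"
proof -
  have cW: "continuous_on S W" using W by (meson DERIV_continuous_on has_field_derivative_at_within)
  have inv: "inv_into S W (W t) = t" if "t \<in> S" for t
    using S(2) that by simp
  have "(inv_into S W has_derivative (*) (inverse (u \<theta>))) (at (W \<theta>))"
    by (rule has_derivative_inverse_strong[OF S(1,3) cW inv W[OF S(3), unfolded has_field_derivative_def]])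
      (use u in \<open>auto simp: fun_eq_iff\<close>)
  then have "(inv_into S W has_real_derivative inverse (u \<theta>)) (at (W \<theta>))"
    by (simp add: has_field_derivative_def)
  moreover have "(E has_real_derivative D) (at (inv_into S W (W \<theta>)))"
    using E inv[OF S(3)] by simp
  ultimately have "((\<lambda>w. E (inv_into S W w)) has_real_derivative D * inverse (u \<theta>)) (at (W \<theta>))"
    by (rule DERIV_chain2[rotated])
  moreover have "open (W ` S)" by (rule invariance_of_domain[OF cW S(1,2)])
  ultimately have "(g has_real_derivative D * inverse (u \<theta>)) (at (W \<theta>))"
    by (rule has_field_derivative_transform_within_open) (use S(3) g inv in auto)
  then show ?thesis by (rule DERIV_imp_deriv)
qed

text \<open>As w(0) = 0, w(t) is t times the mean of w' from 0 to t, and t cancels in the quotient t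
  / w(t). At t = 0 that quotient has the default value of a division by 0, hence the
  exclusion.\<close>

lemma h_fun_along_w_map:
  assumes "real_distribution M" "saddlepoint M x \<noteq> 0" "inj_on (w_map M x) (cgf_open_domain M)"
    and J: "open J" "convex J" "J \<subseteq> cgf_open_domain M" "0 \<in> J" "\<theta> \<in> J - {0}"
    and u: "\<And>t. t \<in> J \<Longrightarrow> (w_map M x has_real_derivative u t) (at t)"
  shows "h_fun M x (w_map M x \<theta>) = - ln (ray_mean 0 0 u \<theta>)"
proof -
  have "theta_map M x (w_map M x \<theta>) = \<theta>"
    unfolding theta_map_def using assms(3) J by (intro inv_into_f_f) auto
  moreover have "w_map M x \<theta> = \<theta> * ray_mean 0 0 u \<theta>"
    using ray_mean_fundamental[OF J(2,4) _ u, of \<theta>] J(5) w_map_at_0[OF assms(1,2)] by auto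
  ultimately have "theta_map M x (w_map M x \<theta>) / w_map M x \<theta> = inverse (ray_mean 0 0 u \<theta>)"
    using J(5) by (simp add: inverse_eq_divide)
  then have "h_fun M x (w_map M x \<theta>) = ln (inverse (ray_mean 0 0 u \<theta>))"
    unfolding h_fun_def by (rule arg_cong)
  then show ?thesis by (simp add: ln_inverse)
qed

lemma order_bound_upper:
  assumes "order_bound J 0 F"
  obtains B where "B > 0" "\<forall>\<^sub>F e in at_right 0. \<forall>x\<in>J. F e x \<le> B"
proof -
  from assms obtain B where B: "\<forall>\<^sub>F e in at_right 0. \<forall>x\<in>J. \<bar>F e x\<bar> \<le> B * e ^ 0"
    by (auto simp: order_bound_def)
  show ?thesis
  proof (rule that[of "\<bar>B\<bar> + 1"])
    show "\<forall>\<^sub>F e in at_right 0. \<forall>x\<in>J. F e x \<le> \<bar>B\<bar> + 1"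
      using B by eventually_elim force
  qed simp
qed

lemma graded_continuous:
  assumes "open J" "graded J k F"
  shows "\<forall>\<^sub>F e in at_right 0. continuous_on J (F e)"
  using graded_derivative(2)[OF assms]
proof eventually_elim
  case (elim e)
  show ?case
    by (rule DERIV_continuous_on, rule has_field_derivative_at_within) (rule elim[rule_format])
qed

lemma graded_ray_mean_ge:
  assumes J: "open J" "convex J" "\<forall>\<^sub>F e in at_right 0. a e \<in> J" and F: "graded J k F"
    and c: "\<forall>\<^sub>F e in at_right 0. \<forall>x\<in>J. c \<le> F e x"
  shows "\<forall>\<^sub>F e in at_right 0. \<forall>x\<in>J. c / (m + 1) \<le> ray_mean m (a e) (F e) x"
  using J(3) graded_continuous[OF J(1) F] c
proof eventually_elim
  case (elim e)
  show ?case
    by (intro ballI ray_mean_ge[OF J(2) elim(1) _ elim(2)]) (use elim(3) in auto)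
qed

text \<open>The induction carries an identity on all of \<open>J - {0}\<close>, because the next
  derivative at a point depends on a neighbourhood. \<open>E\<close> is graded on the whole of
  \<open>J\<close> nevertheless, as it is built from means over segments in this convex set.\<close>

lemma h_fun_derivatives_graded:
  fixes \<mu> :: "real \<Rightarrow> real measure" and x :: real
  defines "s \<equiv> \<lambda>e. saddlepoint (\<mu> e) x"
  assumes J: "open J" "convex J" "0 \<in> J" and \<delta>: "\<delta> > 0"
    and M: "\<forall>\<^sub>F e in at_right 0. real_distribution (\<mu> e) \<and> J \<subseteq> cgf_open_domain (\<mu> e) \<and>
      (\<forall>\<theta>\<in>cgf_open_domain (\<mu> e). \<delta> \<le> (deriv ^^ 2) (cgf (\<mu> e)) \<theta>)"
    and s: "\<forall>\<^sub>F e in at_right 0. s e \<in> J \<and> s e \<noteq> 0 \<and> deriv (cgf (\<mu> e)) (s e) = x"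
    and K: "graded J 0 (\<lambda>e. (deriv ^^ 2) (cgf (\<mu> e)))"
  shows "\<exists>E. graded J n E \<and> (\<forall>\<^sub>F e in at_right 0. \<forall>\<theta>\<in>J - {0}.
      (deriv ^^ n) (h_fun (\<mu> e) x) (w_map (\<mu> e) x \<theta>) = E e \<theta>)"
proof -
  have sJ: "\<forall>\<^sub>F e in at_right 0. s e \<in> J" using s by eventually_elim auto
  have K_ge: "\<forall>\<^sub>F e in at_right 0. \<forall>\<theta>\<in>J. \<delta> \<le> (deriv ^^ 2) (cgf (\<mu> e)) \<theta>"
    using M by eventually_elim auto
  define r where "r e = ray_mean 0 (s e) ((deriv ^^ 2) (cgf (\<mu> e)))" for e
  define q where "q e = ray_mean 1 (s e) (r e)" for e
  \<comment> \<open>\<open>p\<close> is the root in the formula for w, \<open>u\<close> turns out to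
    be w', and \<open>v\<close> the quotient w(t) / t for nonzero t.\<close>
  define p where "p e \<theta> = sqrt (2 * q e \<theta>)" for e \<theta>
  define u where "u e \<theta> = r e \<theta> * inverse (p e \<theta>)" for e \<theta>
  define v where "v e = ray_mean 0 0 (u e)" for e
  have r: "graded J 0 r" unfolding r_def by (rule graded_ray_mean[OF J(1,2) sJ K])
  have r_ge: "\<forall>\<^sub>F e in at_right 0. \<forall>\<theta>\<in>J. \<delta> \<le> r e \<theta>"
    using graded_ray_mean_ge[OF J(1,2) sJ K K_ge, of 0] by (simp add: r_def)
  have q: "graded J 0 q" unfolding q_def by (rule graded_ray_mean[OF J(1,2) sJ r])
  have q_ge: "\<forall>\<^sub>F e in at_right 0. \<forall>\<theta>\<in>J. \<delta> / 2 \<le> q e \<theta>"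
    using graded_ray_mean_ge[OF J(1,2) sJ r r_ge, of 1] by (simp add: q_def)
  \<comment> \<open>The weight in \<open>q\<close> has mass 1 / 2, which halved the lower bound;
    doubling restores it.\<close>
  then have q2_ge: "\<forall>\<^sub>F e in at_right 0. \<forall>\<theta>\<in>J. \<delta> \<le> 2 * q e \<theta>"
    by eventually_elim force
  have p: "graded J 0 p"
    unfolding p_def by (rule graded_sqrt[OF \<delta> q2_ge graded_cmult[OF q]])
  have p_ge: "\<forall>\<^sub>F e in at_right 0. \<forall>\<theta>\<in>J. sqrt \<delta> \<le> p e \<theta>"
    using q2_ge by eventually_elim (simp add: p_def)
  have sqrt\<delta>: "sqrt \<delta> > 0" using \<delta> by simp
  obtain B where B: "B > 0" "\<forall>\<^sub>F e in at_right 0. \<forall>\<theta>\<in>J. p e \<theta> \<le> B"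
    using order_bound_upper[OF graded_order_bound[OF p]] .
  \<comment> \<open>Lower bound of u = r / p, from r >= \<delta> and p <= B.\<close>
  define c where "c = \<delta> * inverse B"
  have c: "c > 0" using \<delta> B by (simp add: c_def)
  have u: "graded J 0 u"
    using graded_mult[OF r graded_inverse[OF sqrt\<delta> p_ge p]] by (simp add: u_def[abs_def])
  have u_ge: "\<forall>\<^sub>F e in at_right 0. \<forall>\<theta>\<in>J. c \<le> u e \<theta>"
    using r_ge p_ge B(2)
  proof eventually_elim
    case (elim e)
    show ?case
    proof
      fix \<theta> assume \<theta>: "\<theta> \<in> J"
      have "sqrt \<delta> \<le> p e \<theta>" using elim(2) \<theta> by blast
      with sqrt\<delta> have "0 < p e \<theta>" by linarith
      then show "c \<le> u e \<theta>" unfolding c_def u_def using elim \<theta> \<delta> B(1)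
        by (intro mult_mono le_imp_inverse_le) force+
    qed
  qed
  have J0: "\<forall>\<^sub>F e in at_right (0::real). 0 \<in> J" using J by simp
  have v: "graded J 0 v" unfolding v_def by (rule graded_ray_mean[OF J(1,2) J0 u])
  have v_ge: "\<forall>\<^sub>F e in at_right 0. \<forall>\<theta>\<in>J. c \<le> v e \<theta>"
    using graded_ray_mean_ge[OF J(1,2) J0 u u_ge, of 0] by (simp add: v_def)
  have inj: "\<forall>\<^sub>F e in at_right 0. inj_on (w_map (\<mu> e) x) (cgf_open_domain (\<mu> e))"
    using M s
  proof eventually_elim
    case (elim e)
    show ?case by (rule w_map_inj[of _ _ "s e"]) (use elim \<delta> in \<open>auto simp: s_def intro: less_le_trans\<close>)
  qed
  have w': "\<forall>\<^sub>F e in at_right 0. \<forall>\<theta>\<in>J. (w_map (\<mu> e) x has_real_derivative u e \<theta>) (at \<theta>)"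
    using M s q_ge graded_derivative(2)[OF J(1) q]
  proof eventually_elim
    case (elim e)
    have q_pos: "q e t > 0" if "t \<in> J" for t using elim(3) that \<delta> by force
    show ?case
    proof
      fix \<theta> assume "\<theta> \<in> J"
      then show "(w_map (\<mu> e) x has_real_derivative u e \<theta>) (at \<theta>)"
        unfolding u_def p_def r_def q_def
        using elim q_pos J
        by (intro w_map_derivative[where s = "s e" and J = J and q' = "deriv (q e)"])
          (auto simp: s_def q_def r_def)
    qed
  qed
  show ?thesis
  proof (induction n)
    case 0
    show ?case
    proof (intro exI conjI)
      show "graded J 0 (\<lambda>e \<theta>. (- 1) * ln (v e \<theta>))"
        by (rule graded_cmult[OF graded_ln[OF J(1) c v_ge v]])
      show "\<forall>\<^sub>F e in at_right 0. \<forall>\<theta>\<in>J - {0}.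
          (deriv ^^ 0) (h_fun (\<mu> e) x) (w_map (\<mu> e) x \<theta>) = (- 1) * ln (v e \<theta>)"
        using M s inj w'
      proof eventually_elim
        case (elim e)
        then show ?case
          using h_fun_along_w_map[of "\<mu> e" x J _ "u e"] J by (simp add: v_def s_def)
      qed
    qed
  next
    case (Suc n)
    then obtain E where E: "graded J n E" "\<forall>\<^sub>F e in at_right 0. \<forall>\<theta>\<in>J - {0}.
      (deriv ^^ n) (h_fun (\<mu> e) x) (w_map (\<mu> e) x \<theta>) = E e \<theta>" by blast
    show ?case
    proof (intro exI conjI)
      \<comment> \<open>Differentiating \<open>E\<close> gains the power; dividing by w' costs
        none.\<close>
      show "graded J (Suc n) (\<lambda>e \<theta>. deriv (E e) \<theta> * inverse (u e \<theta>))"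
        using graded_mult[OF graded_derivative(1)[OF J(1) E(1)] graded_inverse[OF c u_ge u]] by simp
      show "\<forall>\<^sub>F e in at_right 0. \<forall>\<theta>\<in>J - {0}.
          (deriv ^^ Suc n) (h_fun (\<mu> e) x) (w_map (\<mu> e) x \<theta>) = deriv (E e) \<theta> * inverse (u e \<theta>)"
        using M inj w' u_ge E(2) graded_derivative(2)[OF J(1) E(1)]
      proof eventually_elim
        case (elim e)
        show ?case
        proof
          fix \<theta> assume \<theta>: "\<theta> \<in> J - {0}"
          have "u e \<theta> \<noteq> 0" using elim(4) \<theta> c by force
          moreover have "inj_on (w_map (\<mu> e) x) (J - {0})"
            using elim(1,2) by (auto intro: inj_on_subset)
          ultimately show "(deriv ^^ Suc n) (h_fun (\<mu> e) x) (w_map (\<mu> e) x \<theta>) =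
              deriv (E e) \<theta> * inverse (u e \<theta>)"
            using elim \<theta> J(1) deriv_along_inverse[where S = "J - {0}" and E = "E e" and u = "u e"
              and W = "w_map (\<mu> e) x" and \<theta> = \<theta> and D = "deriv (E e) \<theta>"
              and g = "(deriv ^^ n) (h_fun (\<mu> e) x)"]
            by (auto simp: open_delete)
        qed
      qed
    qed
  qed
qed

section \<open>The asymptotic bounds\<close>

text \<open>Each endpoint lies in some \<open>I \<epsilon>\<close> and, by monotonicity, in all
  those with smaller parameter; convexity of the domain fills the segment. The parameters include 0,
  which later makes the limit cgf finite everywhere.\<close>

lemma segment_subset_cgf_domain:
  assumes distr: "\<And>\<epsilon>. \<epsilon> \<in> {0..1} \<Longrightarrow> real_distribution (\<mu> \<epsilon>)"
    and I: "\<And>\<epsilon>. \<epsilon> \<in> {0..1} \<Longrightarrow> I \<epsilon> \<subseteq> cgf_domain (\<mu> \<epsilon>)"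
    and mono: "\<And>\<epsilon> \<epsilon>'. \<epsilon> \<in> {0..1} \<Longrightarrow> \<epsilon>' \<in> {0..1} \<Longrightarrow> \<epsilon>' \<le> \<epsilon> \<Longrightarrow> I \<epsilon> \<subseteq> I \<epsilon>'"
    and exhaust: "(\<Union>\<epsilon>\<in>{0<..1}. I \<epsilon>) = UNIV"
  shows "\<exists>\<epsilon>\<^sub>1::real. 0 < \<epsilon>\<^sub>1 \<and> (\<forall>\<epsilon>\<in>{0..\<epsilon>\<^sub>1}. {a..b} \<subseteq> cgf_domain (\<mu> \<epsilon>))"
proof -
  from exhaust have "a \<in> (\<Union>\<epsilon>\<in>{0<..1}. I \<epsilon>)" "b \<in> (\<Union>\<epsilon>\<in>{0<..1}. I \<epsilon>)" by simp_all
  then obtain e f where e: "e \<in> {0<..1}" "a \<in> I e" and f: "f \<in> {0<..1}" "b \<in> I f" by blast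
  show ?thesis
  proof (intro exI[of _ "min e f"] conjI ballI)
    fix \<epsilon> :: real assume \<epsilon>: "\<epsilon> \<in> {0..min e f}"
    then have \<epsilon>1: "\<epsilon> \<in> {0..1}" using e by auto
    have "a \<in> I \<epsilon>" using mono[of e \<epsilon>] e \<epsilon> \<epsilon>1 by auto
    moreover have "b \<in> I \<epsilon>" using mono[of f \<epsilon>] f \<epsilon> \<epsilon>1 by auto
    ultimately have ab: "a \<in> cgf_domain (\<mu> \<epsilon>)" "b \<in> cgf_domain (\<mu> \<epsilon>)" using I[OF \<epsilon>1] by auto
    have "is_interval (cgf_domain (\<mu> \<epsilon>))"
      using convex_cgf_domain[OF distr[OF \<epsilon>1]] by (simp add: is_interval_convex_1)
    then show "{a..b} \<subseteq> cgf_domain (\<mu> \<epsilon>)"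
      using mem_is_interval_1_I[OF _ ab] by (meson atLeastAtMost_iff subsetI)
  qed (use e f in auto)
qed

text \<open>A real number strictly above the limsup eventually exceeds the supremum, hence each of
  its terms.\<close>

lemma order_bound_of_Limsup:
  fixes F :: "real \<Rightarrow> real \<Rightarrow> real"
  assumes "Limsup (at_right 0) (\<lambda>\<epsilon>. SUP \<theta>\<in>K. ereal (\<bar>F \<epsilon> \<theta>\<bar> / \<epsilon> ^ k)) < \<infinity>" and "J \<subseteq> K"
  shows "order_bound J k F"
proof -
  from ereal_dense2[OF assms(1)] obtain B
    where "Limsup (at_right 0) (\<lambda>\<epsilon>. SUP \<theta>\<in>K. ereal (\<bar>F \<epsilon> \<theta>\<bar> / \<epsilon> ^ k)) < ereal B" by blast
  from Limsup_lessD[OF this]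
  have "\<forall>\<^sub>F \<epsilon> in at_right 0. (SUP \<theta>\<in>K. ereal (\<bar>F \<epsilon> \<theta>\<bar> / \<epsilon> ^ k)) < ereal B" .
  moreover have "\<forall>\<^sub>F \<epsilon> in at_right (0::real). \<epsilon> > 0" by (rule eventually_at_right_less)
  ultimately have "\<forall>\<^sub>F \<epsilon> in at_right 0. \<forall>\<theta>\<in>J. \<bar>F \<epsilon> \<theta>\<bar> \<le> B * \<epsilon> ^ k"
  proof eventually_elim
    case (elim \<epsilon>)
    show ?case
    proof
      fix \<theta> assume "\<theta> \<in> J"
      with assms(2) have "ereal (\<bar>F \<epsilon> \<theta>\<bar> / \<epsilon> ^ k) \<le> (SUP \<theta>\<in>K. ereal (\<bar>F \<epsilon> \<theta>\<bar> / \<epsilon> ^ k))"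
        by (intro SUP_upper) auto
      with elim(1) have "ereal (\<bar>F \<epsilon> \<theta>\<bar> / \<epsilon> ^ k) < ereal B" by (rule le_less_trans[rotated])
      then have "\<bar>F \<epsilon> \<theta>\<bar> / \<epsilon> ^ k < B" by simp
      then show "\<bar>F \<epsilon> \<theta>\<bar> \<le> B * \<epsilon> ^ k" using elim(2) by (simp add: pos_divide_less_eq)
    qed
  qed
  then show ?thesis by (auto simp: order_bound_def)
qed

text \<open>This serves K'' itself, for which (A5) supplies convergence but no power of the
  parameter: the distance to a bounded limit is eventually below 1.\<close>

lemma order_bound_of_uniform_limit:
  assumes "uniform_limit K F f (at_right 0)" "compact K" "continuous_on K f" "J \<subseteq> K"
  shows "order_bound J 0 F"
proof -
  have "bounded (f ` K)" using assms by (intro compact_imp_bounded compact_continuous_image)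
  then obtain B where B: "\<And>\<theta>. \<theta> \<in> K \<Longrightarrow> \<bar>f \<theta>\<bar> \<le> B" by (auto simp: bounded_iff)
  have "\<forall>\<^sub>F \<epsilon> in at_right 0. \<forall>\<theta>\<in>K. dist (F \<epsilon> \<theta>) (f \<theta>) < 1"
    by (rule uniform_limitD[OF assms(1)]) simp
  then have "\<forall>\<^sub>F \<epsilon> in at_right 0. \<forall>\<theta>\<in>J. \<bar>F \<epsilon> \<theta>\<bar> \<le> (B + 1) * \<epsilon> ^ 0"
  proof eventually_elim
    case (elim \<epsilon>)
    show ?case
    proof
      fix \<theta> assume "\<theta> \<in> J"
      with assms(4) have \<theta>: "\<theta> \<in> K" by auto
      from elim[rule_format, OF \<theta>] B[OF \<theta>] show "\<bar>F \<epsilon> \<theta>\<bar> \<le> (B + 1) * \<epsilon> ^ 0"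
        by (simp add: dist_real_def)
    qed
  qed
  then show ?thesis unfolding order_bound_def by blast
qed

text \<open>The shift by 2 is the exponent \<open>r - 2\<close> of (A5): the derivative of order k +
  2 has size \<epsilon>^k, so K'' starts the scale at 0.\<close>

lemma graded_cgf:
  assumes O: "\<forall>\<^sub>F \<epsilon> in at_right 0. real_distribution (\<mu> \<epsilon>) \<and> J \<subseteq> cgf_open_domain (\<mu> \<epsilon>)"
    and b: "\<And>k. order_bound J k (\<lambda>\<epsilon>. (deriv ^^ (k + 2)) (cgf (\<mu> \<epsilon>)))"
  shows "graded J 0 (\<lambda>\<epsilon>. (deriv ^^ 2) (cgf (\<mu> \<epsilon>)))"
proof -
  have "graded_upto J N k (\<lambda>\<epsilon>. (deriv ^^ (k + 2)) (cgf (\<mu> \<epsilon>)))" for N k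
  proof (induction N arbitrary: k)
    case 0
    show ?case using b by simp
  next
    case (Suc N)
    have "\<forall>\<^sub>F \<epsilon> in at_right 0. \<forall>\<theta>\<in>J. ((deriv ^^ (k + 2)) (cgf (\<mu> \<epsilon>)) has_real_derivative
        (deriv ^^ (Suc k + 2)) (cgf (\<mu> \<epsilon>)) \<theta>) (at \<theta>)"
      using O
    proof eventually_elim
      case (elim \<epsilon>)
      show ?case
      proof
        fix \<theta> assume "\<theta> \<in> J"
        then show "((deriv ^^ (k + 2)) (cgf (\<mu> \<epsilon>)) has_real_derivative
            (deriv ^^ (Suc k + 2)) (cgf (\<mu> \<epsilon>)) \<theta>) (at \<theta>)"
          using cgf_higher_derivative[of "\<mu> \<epsilon>" \<theta> "k + 2"] elim by auto
      qed
    qed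
    with Suc.IH[of "Suc k"] b[of k] show ?case
      unfolding graded_upto.simps
      by (intro conjI exI[of _ "\<lambda>\<epsilon>. (deriv ^^ (Suc k + 2)) (cgf (\<mu> \<epsilon>))"])
  qed
  from this[of _ 0] show ?thesis unfolding graded_def add_0 by blast
qed

theorem theorem3:
  fixes \<mu> :: "real \<Rightarrow> real measure" and x :: real and C :: "nat \<Rightarrow> real"
  assumes distr: "\<And>\<epsilon>. \<epsilon> \<in> {0..1} \<Longrightarrow> real_distribution (\<mu> \<epsilon>)"
    and x: "(LINT y|\<mu> 0. y) \<noteq> x"
    and A1: "\<And>\<epsilon>. \<epsilon> \<in> {0..1} \<Longrightarrow> \<exists>a b. 0 \<in> {a<..<b} \<and> {a<..<b} \<subseteq> cgf_domain (\<mu> \<epsilon>)"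
    and A2_support: "\<And>\<epsilon>. \<epsilon> \<in> {0..1} \<Longrightarrow> measure_support (\<mu> \<epsilon>) = UNIV"
    and A2_char: "\<And>\<epsilon>. \<epsilon> \<in> {0..1} \<Longrightarrow> integrable lborel (char (\<mu> \<epsilon>))"
    and A3: "\<exists>\<delta>>0. \<forall>\<epsilon>\<in>{0..1}. \<forall>\<theta>\<in>cgf_open_domain (\<mu> \<epsilon>). (deriv ^^ 2) (cgf (\<mu> \<epsilon>)) \<theta> \<ge> \<delta>"
    and A4: "\<exists>I :: real \<Rightarrow> real set.
        (\<forall>\<epsilon>\<in>{0..1}. is_interval (I \<epsilon>) \<and> I \<epsilon> \<subseteq> cgf_domain (\<mu> \<epsilon>)) \<and>
        (\<forall>\<epsilon>\<in>{0..1}. \<forall>\<epsilon>'\<in>{0..1}. \<epsilon>' \<le> \<epsilon> \<longrightarrow> I \<epsilon> \<subseteq> I \<epsilon>') \<and>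
        (\<Union>\<epsilon>\<in>{0<..1}. I \<epsilon>) = UNIV"
    and A5_conv: "\<And>r K. compact K \<Longrightarrow>
        uniform_limit K (\<lambda>\<epsilon>. (deriv ^^ r) (cgf (\<mu> \<epsilon>))) ((deriv ^^ r) (cgf (\<mu> 0))) (at_right 0)"
    and A5_bound: "\<And>r K. r \<ge> 3 \<Longrightarrow> compact K \<Longrightarrow>
        Limsup (at_right 0)
          (\<lambda>\<epsilon>. SUP \<theta>\<in>K. ereal (\<bar>(deriv ^^ r) (cgf (\<mu> \<epsilon>)) \<theta>\<bar> / \<epsilon> ^ (r - 2))) < \<infinity>"
    and C_pos: "\<And>n. n \<ge> 2 \<Longrightarrow> C n > 0"
    and C_bound: "\<And>n. n \<ge> 2 \<Longrightarrow>
        \<forall>\<^sub>F \<epsilon> in at_right 0. \<bar>theta_hat_deriv n (\<mu> \<epsilon>) x\<bar> \<le> C n * \<epsilon> ^ (n - 1)"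
    and A6: "\<exists>\<epsilon>\<^sub>0. \<epsilon>\<^sub>0 \<in> {0<..1} \<and> summable (\<lambda>k. C (k + 2) / fact (k + 2) * \<epsilon>\<^sub>0 ^ (k + 2))"
  shows "(\<forall>n\<ge>1. (\<lambda>\<epsilon>. (deriv ^^ n) (h_fun (\<mu> \<epsilon>) x) (w_hat (\<mu> \<epsilon>) x)) \<in> O[at_right 0](\<lambda>\<epsilon>. \<epsilon> ^ n)) \<and>
         (\<forall>m. (\<lambda>\<epsilon>. Psi_fun m (\<mu> \<epsilon>) x (w_hat (\<mu> \<epsilon>) x)) \<in> O[at_right 0](\<lambda>\<epsilon>. \<epsilon> ^ (2 * m + 1)))"
proof -
  from A3 obtain \<delta> where \<delta>: "\<delta> > 0"
    "\<And>\<epsilon> \<theta>. \<epsilon> \<in> {0..1} \<Longrightarrow> \<theta> \<in> cgf_open_domain (\<mu> \<epsilon>) \<Longrightarrow> \<delta> \<le> (deriv ^^ 2) (cgf (\<mu> \<epsilon>)) \<theta>"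
    by blast
  from A4 obtain I :: "real \<Rightarrow> real set" where
    I: "\<And>\<epsilon>. \<epsilon> \<in> {0..1} \<Longrightarrow> I \<epsilon> \<subseteq> cgf_domain (\<mu> \<epsilon>)"
    and I_mono: "\<And>\<epsilon> \<epsilon>'. \<epsilon> \<in> {0..1} \<Longrightarrow> \<epsilon>' \<in> {0..1} \<Longrightarrow> \<epsilon>' \<le> \<epsilon> \<Longrightarrow> I \<epsilon> \<subseteq> I \<epsilon>'"
    and I_exhaust: "(\<Union>\<epsilon>\<in>{0<..1}. I \<epsilon>) = UNIV" by metis
  have segment: "\<exists>\<epsilon>\<^sub>1::real. 0 < \<epsilon>\<^sub>1 \<and> (\<forall>\<epsilon>\<in>{0..\<epsilon>\<^sub>1}. {a..b} \<subseteq> cgf_domain (\<mu> \<epsilon>))" for a b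
    by (rule segment_subset_cgf_domain[of \<mu> I, OF distr I I_mono I_exhaust])
  have unit: "\<forall>\<^sub>F \<epsilon> in at_right (0::real). \<epsilon> \<in> {0..1}"
    using eventually_at_right_real[of 0 1] by (auto elim!: eventually_mono)
  have M0: "real_distribution (\<mu> 0)" using distr by simp
  have O0: "cgf_open_domain (\<mu> 0) = UNIV"
  proof -
    have "t \<in> cgf_domain (\<mu> 0)" for t
      using segment[of t t] by auto
    then have "cgf_domain (\<mu> 0) = UNIV" by blast
    then show ?thesis by (simp add: cgf_open_domain_def)
  qed
  define K\<^sub>1 where "K\<^sub>1 \<epsilon> = deriv (cgf (\<mu> \<epsilon>))" for \<epsilon>
  have K1_deriv: "(K\<^sub>1 0 has_real_derivative (deriv ^^ 2) (cgf (\<mu> 0)) t) (at t)" for t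
    using cgf_higher_derivative[OF M0, of t 1] O0 by (simp add: K\<^sub>1_def numeral_2_eq_2)
  have K1_growth: "K\<^sub>1 0 b - K\<^sub>1 0 a \<ge> \<delta> * (b - a)" if "a < b" for a b
  proof -
    from MVT2[OF that, of "K\<^sub>1 0" "(deriv ^^ 2) (cgf (\<mu> 0))"] K1_deriv
    obtain z where "K\<^sub>1 0 b - K\<^sub>1 0 a = (b - a) * (deriv ^^ 2) (cgf (\<mu> 0)) z" by blast
    moreover have "(b - a) * (deriv ^^ 2) (cgf (\<mu> 0)) z \<ge> (b - a) * \<delta>"
      using \<delta>(2)[of 0 z] O0 that by (intro mult_left_mono) auto
    ultimately show ?thesis by (simp add: mult.commute)
  qed
  \<comment> \<open>By linear growth, moving a distance \<open>R\<close> from 0 changes K_0' by at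
    least |x - K_0'(0)| + 1 and so carries it past \<open>x\<close>. The surplus 1 makes the
    inequalities at both endpoints strict, so they persist for small parameters.\<close>
  define R where "R = (\<bar>x - K\<^sub>1 0 0\<bar> + 1) / \<delta>"
  have R: "R > 0" "\<delta> * R = \<bar>x - K\<^sub>1 0 0\<bar> + 1" using \<delta>(1) by (simp_all add: R_def)
  have K1_R: "x < K\<^sub>1 0 R" "K\<^sub>1 0 (- R) < x"
  proof -
    have "\<delta> * R \<le> K\<^sub>1 0 R - K\<^sub>1 0 0" "\<delta> * R \<le> K\<^sub>1 0 0 - K\<^sub>1 0 (- R)"
      using K1_growth[of 0 R] K1_growth[of "- R" 0] R(1) by simp_all
    with R(2) show "x < K\<^sub>1 0 R" "K\<^sub>1 0 (- R) < x" by linarith+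
  qed
  define J where "J = {- R<..<R}"
  have J: "open J" "convex J" "0 \<in> J" "J \<subseteq> {- R..R}" using R by (auto simp: J_def)
  \<comment> \<open>A margin of 1 on both sides puts the closed interval into the interior of the
    domain.\<close>
  have ev_domain: "\<forall>\<^sub>F \<epsilon> in at_right 0. {- R..R} \<subseteq> cgf_open_domain (\<mu> \<epsilon>)"
  proof -
    obtain \<epsilon>\<^sub>1 :: real where \<epsilon>\<^sub>1: "0 < \<epsilon>\<^sub>1"
      "\<And>\<epsilon>. \<epsilon> \<in> {0..\<epsilon>\<^sub>1} \<Longrightarrow> {- R - 1..R + 1} \<subseteq> cgf_domain (\<mu> \<epsilon>)"
      using segment[of "- R - 1" "R + 1"] by blast
    have "\<forall>\<^sub>F \<epsilon> in at_right 0. \<epsilon> \<in> {0<..<\<epsilon>\<^sub>1}" by (rule eventually_at_right_real[OF \<epsilon>\<^sub>1(1)])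
    then show ?thesis
    proof eventually_elim
      case (elim \<epsilon>)
      then have "interior {- R - 1..R + 1} \<subseteq> cgf_open_domain (\<mu> \<epsilon>)"
        unfolding cgf_open_domain_def using \<epsilon>\<^sub>1(2)[of \<epsilon>] by (intro interior_mono) auto
      then show ?case by (simp add: interior_atLeastAtMost_real subset_iff)
    qed
  qed
  have K1_tendsto: "((\<lambda>\<epsilon>. K\<^sub>1 \<epsilon> t) \<longlongrightarrow> K\<^sub>1 0 t) (at_right 0)" for t
    using tendsto_uniform_limitI[OF A5_conv[of "{t}" 1], of t] by (simp add: K\<^sub>1_def)
  have "K\<^sub>1 0 0 \<noteq> x" using cgf_at_0(2)[OF M0] O0 x by (simp add: K\<^sub>1_def)
  \<comment> \<open>K_0'(0) is the mean of the limit measure; the hypothesis on \<open>x\<close>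
    thus excludes 0 as a saddlepoint in the limit, and convergence at 0 extends this to small
    parameters.\<close>
  then have ev_0: "\<forall>\<^sub>F \<epsilon> in at_right 0. K\<^sub>1 \<epsilon> 0 \<noteq> x"
    by (rule tendsto_imp_eventually_ne[OF K1_tendsto])
  have good: "\<forall>\<^sub>F \<epsilon> in at_right 0. real_distribution (\<mu> \<epsilon>) \<and> J \<subseteq> cgf_open_domain (\<mu> \<epsilon>) \<and>
      (\<forall>\<theta>\<in>cgf_open_domain (\<mu> \<epsilon>). \<delta> \<le> (deriv ^^ 2) (cgf (\<mu> \<epsilon>)) \<theta>)"
    using unit ev_domain by eventually_elim (use J(4) distr \<delta>(2) in auto)
  \<comment> \<open>At -R and R the derivative lies strictly on different sides of \<open>x\<close>,
    so the intermediate value theorem gives a solution inside \<open>J\<close>; the lower bound on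
    K'' makes it the only one in the open domain.\<close>
  have saddle: "\<forall>\<^sub>F \<epsilon> in at_right 0. saddlepoint (\<mu> \<epsilon>) x \<in> J \<and> saddlepoint (\<mu> \<epsilon>) x \<noteq> 0 \<and>
      deriv (cgf (\<mu> \<epsilon>)) (saddlepoint (\<mu> \<epsilon>) x) = x"
    using good ev_domain ev_0 order_tendstoD(1)[OF K1_tendsto K1_R(1)] order_tendstoD(2)[OF K1_tendsto K1_R(2)]
  proof eventually_elim
    case (elim \<epsilon>)
    have M: "real_distribution (\<mu> \<epsilon>)" using elim(1) by blast
    have "continuous_on {- R..R} (K\<^sub>1 \<epsilon>)"
    proof (rule DERIV_continuous_on, rule has_field_derivative_at_within)
      fix t assume "t \<in> {- R..R}"
      then show "(K\<^sub>1 \<epsilon> has_real_derivative (deriv ^^ Suc 1) (cgf (\<mu> \<epsilon>)) t) (at t)"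
        using cgf_higher_derivative[OF M, of t 1] elim(2) by (auto simp: K\<^sub>1_def)
    qed
    then obtain s where s: "- R \<le> s" "s \<le> R" "K\<^sub>1 \<epsilon> s = x"
      using IVT'[of "K\<^sub>1 \<epsilon>" "- R" x R] elim(4,5) R(1) by auto
    have "s \<noteq> - R" "s \<noteq> R" "s \<noteq> 0" using s(3) elim(3-5) by auto
    then have "s \<in> J" using s by (auto simp: J_def)
    moreover have "saddlepoint (\<mu> \<epsilon>) x = s"
      using elim(1) \<open>s \<in> J\<close> s(3) \<delta>(1)
      by (intro saddlepoint_eqI) (auto simp: K\<^sub>1_def intro: less_le_trans)
    ultimately show ?case using s(3) \<open>s \<noteq> 0\<close> by (simp add: K\<^sub>1_def)
  qed
  have bound: "order_bound J k (\<lambda>\<epsilon>. (deriv ^^ (k + 2)) (cgf (\<mu> \<epsilon>)))" for k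
  proof (cases "k = 0")
    case True
    have "continuous_on {- R..R} ((deriv ^^ 2) (cgf (\<mu> 0)))"
      by (rule DERIV_continuous_on, rule has_field_derivative_at_within,
        rule cgf_higher_derivative[OF M0]) (simp add: O0)
    then show ?thesis
      using order_bound_of_uniform_limit[OF A5_conv[of "{- R..R}" 2] _ _ J(4)]
      unfolding True add_0 by simp
  next
    case False
    then have "3 \<le> k + 2" by simp
    from A5_bound[OF this, of "{- R..R}", unfolded add_diff_cancel_right'] show ?thesis
      by (intro order_bound_of_Limsup[OF _ J(4)]) simp
  qed
  have "\<forall>\<^sub>F \<epsilon> in at_right 0. real_distribution (\<mu> \<epsilon>) \<and> J \<subseteq> cgf_open_domain (\<mu> \<epsilon>)"
    using good by eventually_elim blast
  from graded_cgf[OF this bound]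
  have K: "graded J 0 (\<lambda>\<epsilon>. (deriv ^^ 2) (cgf (\<mu> \<epsilon>)))" .
  have h: "(\<lambda>\<epsilon>. (deriv ^^ n) (h_fun (\<mu> \<epsilon>) x) (w_hat (\<mu> \<epsilon>) x)) \<in> O[at_right 0](\<lambda>\<epsilon>. \<epsilon> ^ n)" for n
  proof -
    obtain E where E: "graded J n E" "\<forall>\<^sub>F \<epsilon> in at_right 0. \<forall>\<theta>\<in>J - {0}.
        (deriv ^^ n) (h_fun (\<mu> \<epsilon>) x) (w_map (\<mu> \<epsilon>) x \<theta>) = E \<epsilon> \<theta>"
      using h_fun_derivatives_graded[OF J(1-3) \<delta>(1) good saddle K] by blast
    from graded_order_bound[OF E(1)] obtain B where
      B: "\<forall>\<^sub>F \<epsilon> in at_right 0. \<forall>\<theta>\<in>J. \<bar>E \<epsilon> \<theta>\<bar> \<le> B * \<epsilon> ^ n" by (auto simp: order_bound_def)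
    show ?thesis
    proof (rule bigoI[of _ B])
      show "\<forall>\<^sub>F \<epsilon> in at_right 0. norm ((deriv ^^ n) (h_fun (\<mu> \<epsilon>) x) (w_hat (\<mu> \<epsilon>) x)) \<le> B * norm (\<epsilon> ^ n)"
        using saddle E(2) B unit
      proof eventually_elim
        case (elim \<epsilon>)
        let ?s = "saddlepoint (\<mu> \<epsilon>) x"
        have "(deriv ^^ n) (h_fun (\<mu> \<epsilon>) x) (w_map (\<mu> \<epsilon>) x ?s) = E \<epsilon> ?s"
          using elim(1,2) by blast
        moreover have "\<bar>E \<epsilon> ?s\<bar> \<le> B * \<epsilon> ^ n" using elim(1,3) by blast
        ultimately show ?case using elim(4) by (simp add: w_map_eq_w_hat_at_saddlepoint)
      qed
    qed
  qed
  have "(\<lambda>\<epsilon>. Psi_fun m (\<mu> \<epsilon>) x (w_hat (\<mu> \<epsilon>) x)) \<in> O[at_right 0](\<lambda>\<epsilon>. \<epsilon> ^ (2 * m + 1))" for m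
  proof -
    \<comment> \<open>The normal density never exceeds its value at 0, so the prefactor is bounded
      wherever \<open>w_hat\<close> moves.\<close>
    have "(\<lambda>\<epsilon>. std_normal_density (w_hat (\<mu> \<epsilon>) x) * ((- 1) ^ m / (\<Prod>k=1..m. 2 * real k)))
        \<in> O[at_right 0](\<lambda>_. 1)"
    proof (rule bigoI[of _ "1 / sqrt (2 * pi) * \<bar>(- 1) ^ m / (\<Prod>k=1..m. 2 * real k)\<bar>"], rule always_eventually, rule allI)
      fix \<epsilon>
      have "\<bar>std_normal_density y\<bar> \<le> 1 / sqrt (2 * pi)" for y
        by (simp add: std_normal_density_def divide_right_mono)
      from mult_right_mono[OF this abs_ge_zero] show "norm (std_normal_density (w_hat (\<mu> \<epsilon>) x) * ((- 1) ^ m / (\<Prod>k=1..m. 2 * real k)))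
          \<le> 1 / sqrt (2 * pi) * \<bar>(- 1) ^ m / (\<Prod>k=1..m. 2 * real k)\<bar> * norm (1::real)"
        unfolding real_norm_def abs_mult abs_one mult_1_right .
    qed
    \<comment> \<open>psi is the first derivative of h, so its derivative of order 2 m is that of h
      of order 2 m + 1; hence the odd exponent.\<close>
    from landau_o.big.mult[OF this h[of "2 * m + 1"]] show ?thesis
      by (simp add: Psi_fun_def psi_fun_def funpow_swap1)
  qed
  with h show ?thesis by blast
qed

end
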